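(* Let $R$ be a finite reference set in a metric space $(X,d)$ with aspect ratio $\Delta(R)$ and minimized expansion constant $c_m(R)$, let $q\in X$ be a query point, $1\le k\le|R|$ an integer and $\epsilon>0$ a real number. Given a compressed cover tree $\mathcal T(R)$, the time complexity of the algorithm $\mathrm{ApproxkNN}(\mathcal T(R),q,k,\epsilon)$ (described in the context), which finds an approximate $k$-nearest neighbors set of $q$, is $$O\Big((c_m(R))^{8+\lceil\log_2(2+\frac1\epsilon)\rceil}\cdot\log_2(k)\cdot\log_2(\Delta(R))+k\Big),$$ where the constant hidden in $O(\cdot)$ is absolute.
   Context: **Approximate neighbors.** Let $d_1\le\dots\le d_{|R|}$ be the ordered distances from $q$ to all points of $R$, $\mathrm{NN}_i(q;R)=\{u\in R: d(q,u)\le d_i\}$ and $\mathcal N_k=\bigcup_{i=1}^k\mathrm{NN}_i(q;R)$. A set $\mathcal P\subseteq R$ is an approximate $k$-nearest neighbors set of $q$ if $|\mathcal P|=k$ and there is an injection $f:\mathcal P\to\mathcal N_k$ with $d(q,p)\le(1+\epsilon)\,d(q,f(p))$ for all $p\in\mathcal P$. **Aspect ratio.** $\mathrm{diam}(R)=\max_{p,q\in R}d(p,q)$, $d_{\min}(R)$ is the shortest distance between distinct points of $R$, and $\Delta(R)=\mathrm{diam}(R)/d_{\min}(R)$. **Minimized expansion constant.** $\bar B(p,t)$ is the closed ball with center $p$ and radius $t\ge 0$. A set $A\subseteq X$ is locally finite if $\bar B(p,t)\cap A$ is finite for all $p\in X$, $t\ge 0$. For finite $R\subseteq X$, $$c_m(R)=\lim_{\xi\to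 0^+}\ \inf_{R\subseteq A\subseteq X}\ \sup_{p\in A,\,t>\xi}\frac{|\bar B(p,2t)\cap A|}{|\bar B(p,t)\cap A|},$$ where $A$ runs over locally finite sets containing $R$. **Compressed cover tree.** For a finite set $R\subseteq X$, a compressed cover tree $\mathcal T(R)$ is a rooted tree with vertex set $R$, a root $r$ and a level function $l:R\to\mathbb Z$ such that: (a) $l(r)\ge 1+\max_{p\in R\setminus\{r\}}l(p)$; (b) every $q\in R\setminus\{r\}$ has a unique parent $p$, and $d(q,p)\le 2^{l(q)+1}$, $l(q)<l(p)$; (c) for each $i\in\mathbb Z$ the cover set $C_i=\{p\in R: l(p)\ge i\}$ satisfies $d(p,q)>2^i$ for all distinct $p,q\in C_i$. Set $l_{\max}=1+\max_{p\in R\setminus\{r\}}l(p)$ and $l_{\min}=\min_{p\in R}l(p)$. $\mathrm{Desc}(p)$ is the set of all descendants of $p$, including $p$. $\mathrm{Next}(a,i)$ is the maximal level $j<i$ such that $a$ has a child (different from $a$) of level $j$; if none exists, $\mathrm{Next}(a,i)=l_{\min}-1$. **Distinctive descendant sets.** For $i\le l(p)$, $\mathcal S_i(p)=\mathrm{Desc}(p)\setminus\bigcup_{u\in V_i(p)}\mathrm{Desc}(u)$, where $V_i(p)=\{u\in\mathrm{Desc}(p): i\le l(u)\le l(p)-1\}$. **$\lambda$-point.** For $C\subseteq C_i$ with $\sum_{p\in C}|\mathcal S_i(p)|\ge k$, $\lambda_k(q,C)$ is a point $\lambda\in C$ minimizing $d(q,\lambda)$ subject to $\sum_{p\in N(q;\lambda)}|\mathcal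 S_i(p)|\ge k$, where $N(q;\lambda)=\{p\in C: d(q,p)\le d(q,\lambda)\}$. It is computed by selecting the $k$ points of $C$ nearest to $q$ (all of $C$ if $|C|<k$) with a binary heap of size at most $k$ and then taking partial sums of the sizes $|\mathcal S_i(p)|$. **Algorithm ApproxkNN$(\mathcal T(R),q,k,\epsilon)$.** Set $R_{l_{\max}}=\{r\}$, $i=l_{\max}-1$, $i^+=l_{\max}$. While $i\ge l_{\min}$: put $\mathcal C_i=R_{i^+}\cup\{a: a\text{ is a child of some }p\in R_{i^+},\ l(a)=i\}$, $\lambda=\lambda_k(q,\mathcal C_i)$ and $R_i=\{p\in\mathcal C_i: d(q,p)\le d(q,\lambda)+2^{i+2}\}$. If $\frac{2^{i+2}}{\epsilon}+2^{i+1}\le d(q,\lambda)$, let $\mathcal P=\bigcup\{\mathcal S_i(p): p\in\mathcal C_i,\ d(p,q)<d(q,\lambda)\}$, then add to $\mathcal P$ points from the sets $\mathcal S_i(p)$ with $p\in\mathcal C_i$, $d(p,q)=d(q,\lambda)$ until $|\mathcal P|=k$, output $\mathcal P$ and stop. Otherwise let $j=\max_{a\in R_i}\mathrm{Next}(a,i)$, set $j^+=i$ and $i\leftarrow j$. If the loop ends without stopping, output the $k$ points nearest to $q$ in the last computed set $R_i$ (selected with a binary heap of size at most $k$). **Cost conventions.** Distance evaluations and elementary operations have unit cost. Children of each node are stored grouped by level in a linked hash map, so that the group at a given level, the passage from $i$ to $\mathrm{Next}(a,i)$, and the top child level are accessible in $O(1)$ time. The sizes $|\mathcal S_i(p)|$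 are assumed precomputed and retrievable in $O(1)$ time. The factors $\log_2(k)$ and $\log_2(\Delta(R))$ inside $O(\cdot)$ are read as $\max\{1,\log_2(\cdot)\}$. *)

theory Defs
  imports "HOL-Analysis.Analysis" "HOL-Library.Tree" "HOL-Library.Monad_Syntax"
begin

section \<open>Metric notions\<close>

text \<open>The ambient metric space $X$ is the universe of the type \<^typ>\<open>'a::metric_space\<close>.\<close>

definition loc_finite :: "'a::metric_space set \<Rightarrow> bool" where
  "loc_finite A \<longleftrightarrow> (\<forall>p t. 0 \<le> t \<longrightarrow> finite (cball p t \<inter> A))"

text \<open>The inner suprema may be infinite, so the limit is taken in \<^typ>\<open>ereal\<close>. For finite nonempty
  \<open>R\<close> the function of \<open>\<xi>\<close> is antitone and (take \<open>A = R\<close>) bounded by \<^term>\<open>card R\<close>; hence the limit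
  exists and is finite.\<close>

definition c_m :: "'a::metric_space set \<Rightarrow> real" where
  "c_m R = real_of_ereal (Lim (at_right (0::real)) (\<lambda>\<xi>.
     INF A \<in> {A. R \<subseteq> A \<and> loc_finite A}.
       SUP (p, t) \<in> {(p, t). p \<in> A \<and> \<xi> < t}.
         ereal (real (card (cball p (2 * t) \<inter> A)) / real (card (cball p t \<inter> A)))))"

definition d_min :: "'a::metric_space set \<Rightarrow> real" where
  "d_min R = Min {dist p q | p q. p \<in> R \<and> q \<in> R \<and> p \<noteq> q}"

text \<open>For a singleton \<open>R\<close> the quotient is undefined; here it is \<open>0 / d_min R = 0\<close>, and the
  factor \<open>max 1 (log 2 (aspect_ratio R))\<close> of the time bound is then \<open>1\<close>.\<close>

definition aspect_ratio :: "'a::metric_space set \<Rightarrow> real" where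
  "aspect_ratio R = diameter R / d_min R"

text \<open>\<open>sorted_dists q R ! (i - 1)\<close> is the $i$-th smallest distance from \<open>q\<close> to \<open>R\<close>, with
  multiplicity.\<close>

definition sorted_dists :: "'a::metric_space \<Rightarrow> 'a set \<Rightarrow> real list" where
  "sorted_dists q R = sorted_list_of_multiset (image_mset (dist q) (mset_set R))"

definition NN :: "'a::metric_space set \<Rightarrow> 'a \<Rightarrow> nat \<Rightarrow> 'a set" where
  "NN R q i = {u \<in> R. dist q u \<le> sorted_dists q R ! (i - 1)}"

definition NN_upto :: "'a::metric_space set \<Rightarrow> 'a \<Rightarrow> nat \<Rightarrow> 'a set" where
  "NN_upto R q k = (\<Union>i\<in>{1..k}. NN R q i)"

definition approx_knn_set :: "'a::metric_space set \<Rightarrow> 'a \<Rightarrow> nat \<Rightarrow> real \<Rightarrow> 'a set \<Rightarrow> bool" where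
  "approx_knn_set R q k \<epsilon> P \<longleftrightarrow>
     P \<subseteq> R \<and> card P = k \<and>
     (\<exists>f. inj_on f P \<and> f ` P \<subseteq> NN_upto R q k \<and>
          (\<forall>p\<in>P. dist q p \<le> (1 + \<epsilon>) * dist q (f p)))"


section \<open>Compressed cover trees\<close>

text \<open>The tree structure is given by the parent map; the value of \<open>parent\<close> at the root is
  irrelevant.\<close>

record 'a cover_tree =
  points :: "'a set"
  root :: 'a
  parent :: "'a \<Rightarrow> 'a"
  level :: "'a \<Rightarrow> int"

definition is_child :: "'a cover_tree \<Rightarrow> 'a \<Rightarrow> 'a \<Rightarrow> bool" where
  "is_child T c p \<longleftrightarrow> c \<in> points T - {root T} \<and> p \<in> points T \<and> parent T c = p"

definition cover_set :: "'a cover_tree \<Rightarrow> int \<Rightarrow> 'a set" where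
  "cover_set T i = {p \<in> points T. i \<le> level T p}"

text \<open>As the level strictly increases from a node to its parent, the parent map cannot have a cycle
  and every node is connected to the root.\<close>

definition compressed_cover_tree :: "'a::metric_space set \<Rightarrow> 'a cover_tree \<Rightarrow> bool" where
  "compressed_cover_tree R T \<longleftrightarrow>
     points T = R \<and> finite R \<and> root T \<in> R \<and>
     (\<forall>p \<in> R - {root T}. 1 + level T p \<le> level T (root T)) \<and>
     (\<forall>q \<in> R - {root T}. parent T q \<in> R \<and>
        dist q (parent T q) \<le> 2 powi (level T q + 1) \<and>
        level T q < level T (parent T q)) \<and>
     (\<forall>i. \<forall>p \<in> cover_set T i. \<forall>q \<in> cover_set T i. p \<noteq> q \<longrightarrow> 2 powi i < dist p q)"

text \<open>If the root is the only node, the maximum in the definition of the top level is over the empty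
  set. The convention below makes the main loop of the algorithm empty in that case.\<close>

definition l_max :: "'a cover_tree \<Rightarrow> int" where
  "l_max T = (if points T = {root T} then level T (root T)
              else 1 + Max (level T ` (points T - {root T})))"

definition l_min :: "'a cover_tree \<Rightarrow> int" where
  "l_min T = Min (level T ` points T)"

definition Desc :: "'a cover_tree \<Rightarrow> 'a \<Rightarrow> 'a set" where
  "Desc T p = {u \<in> points T. (is_child T)\<^sup>*\<^sup>* u p}"

text \<open>A nonempty set of integers that is bounded above contains its supremum, so \<^const>\<open>Sup\<close> is the
  maximum here. Unlike \<^const>\<open>Max\<close> it does not require the set of levels to be finite, which makes
  the functions below terminate on arbitrary records.\<close>

definition Next :: "'a cover_tree \<Rightarrow> 'a \<Rightarrow> int \<Rightarrow> int" where
  "Next T a i = (let L = {level T c | c. is_child T c a \<and> level T c < i} in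
     if L = {} then l_min T - 1 else Sup L)"

definition V_set :: "'a cover_tree \<Rightarrow> int \<Rightarrow> 'a \<Rightarrow> 'a set" where
  "V_set T i p = {u \<in> Desc T p. i \<le> level T u \<and> level T u \<le> level T p - 1}"

definition S_set :: "'a cover_tree \<Rightarrow> int \<Rightarrow> 'a \<Rightarrow> 'a set" where
  "S_set T i p = Desc T p - (\<Union>u \<in> V_set T i p. Desc T u)"

text \<open>The stored child groups: \<open>G p j\<close> lists the children of \<open>p\<close> of level \<open>j\<close>, in any order.\<close>

definition child_groups :: "'a cover_tree \<Rightarrow> ('a \<Rightarrow> int \<Rightarrow> 'a list) \<Rightarrow> bool" where
  "child_groups T G \<longleftrightarrow>
     (\<forall>p \<in> points T. \<forall>j. distinct (G p j) \<and> set (G p j) = {c. is_child T c p \<and> level T c = j})"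

lemma Next_less:
  assumes "l_min T \<le> Next T a i"
  shows "Next T a i < i"
proof -
  define L where "L = {level T c | c. is_child T c a \<and> level T c < i}"
  have "L \<noteq> {}" using assms by (auto simp: Next_def L_def Let_def split: if_splits)
  moreover have "Sup L \<le> i - 1"
    by (rule cSup_least) (use \<open>L \<noteq> {}\<close> in \<open>auto simp: L_def\<close>)
  ultimately show ?thesis unfolding Next_def Let_def L_def[symmetric] by simp
qed

lemma Next_less':
  assumes "l_min T \<le> i"
  shows "Next T a i < i"
  using Next_less[of T a i] assms by linarith


section \<open>Cost model\<close>

text \<open>A computation consists of a result and of the number of unit-cost steps used to obtain it.
  \<open>step x\<close> stands for a single elementary operation with result \<open>x\<close>: a distance evaluation, a lookup
  in the stored tree (child group, \<^const>\<open>Next\<close>, \<open>card (S_set T i p)\<close>, \<^const>\<open>l_max\<close>, \<^const>\<open>l_min\<close>), or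
  boundedly many list, tree, arithmetic and comparison operations. \<open>ret\<close> is free of charge and is only
  used together with steps charged in the same equation.\<close>

datatype 'b timed = Timed (result: 'b) (time: nat)

definition ret :: "'b \<Rightarrow> 'b timed" where
  "ret x = Timed x 0"

definition step :: "'b \<Rightarrow> 'b timed" where
  "step x = Timed x 1"

definition bind_timed :: "'b timed \<Rightarrow> ('b \<Rightarrow> 'c timed) \<Rightarrow> 'c timed" where
  "bind_timed m f = Timed (result (f (result m))) (time m + time (f (result m)))"

adhoc_overloading Monad_Syntax.bind == bind_timed

lemma result_time_simps [simp]:
  "result (ret x) = x" "time (ret x) = 0"
  "result (step x) = x" "time (step x) = 1"
  "result (bind_timed m f) = result (f (result m))"
  "time (bind_timed m f) = time m + time (f (result m))"
  by (simp_all add: ret_def step_def bind_timed_def)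

lemma bind_timed_cong [fundef_cong]:
  "m = n \<Longrightarrow> (\<And>x. x = result n \<Longrightarrow> f x = g x) \<Longrightarrow> bind_timed m f = bind_timed n g"
  by (simp add: bind_timed_def)


section \<open>Binary heaps\<close>

text \<open>Max-heaps of pairs (distance to the query point, point), ordered by the distance. The heap is a
  binary tree whose shape is kept balanced (left subtrees have the size of their right siblings or
  one more) by exchanging the two subtrees on insertion and on deletion.\<close>

type_synonym 'a entry = "real \<times> 'a"

fun heap_insert :: "'a entry \<Rightarrow> 'a entry tree \<Rightarrow> 'a entry tree timed" where
  "heap_insert x Leaf = step (Node Leaf x Leaf)"
| "heap_insert x (Node l a r) = do {
     step ();
     if fst a \<le> fst x
     then do { r' \<leftarrow> heap_insert a r; ret (Node r' x l) }
     else do { r' \<leftarrow> heap_insert x r; ret (Node r' a l) }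
   }"

text \<open>\<open>sift_down l x r\<close> makes a heap from the heaps \<open>l\<close>, \<open>r\<close> and a new entry \<open>x\<close> in place of the
  root. A nonempty right subtree has a nonempty left sibling.\<close>

function sift_down :: "'a entry tree \<Rightarrow> 'a entry \<Rightarrow> 'a entry tree \<Rightarrow> 'a entry tree timed" where
  "sift_down Leaf x r = step (Node Leaf x r)"
| "sift_down (Node l1 a1 r1) x Leaf =
     (if fst a1 \<le> fst x then step (Node (Node l1 a1 r1) x Leaf)
      else do { step (); l' \<leftarrow> sift_down l1 x r1; ret (Node l' a1 Leaf) })"
| "sift_down (Node l1 a1 r1) x (Node l2 a2 r2) =
     (if fst a1 \<le> fst x \<and> fst a2 \<le> fst x
      then step (Node (Node l1 a1 r1) x (Node l2 a2 r2))
      else if fst a2 \<le> fst a1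
      then do { step (); l' \<leftarrow> sift_down l1 x r1; ret (Node l' a1 (Node l2 a2 r2)) }
      else do { step (); r' \<leftarrow> sift_down l2 x r2; ret (Node (Node l1 a1 r1) a2 r') })"
  by pat_completeness auto
termination by (relation "measures [\<lambda>(l, x, r). size l + size r]") auto

fun replace_max :: "'a entry \<Rightarrow> 'a entry tree \<Rightarrow> 'a entry tree timed" where
  "replace_max x Leaf = step Leaf"
| "replace_max x (Node l a r) = sift_down l x r"

text \<open>\<open>remove_left a l r\<close> removes from \<open>Node l a r\<close> the entry at the end of the leftmost path.\<close>

fun remove_left ::
  "'a entry \<Rightarrow> 'a entry tree \<Rightarrow> 'a entry tree \<Rightarrow> ('a entry \<times> 'a entry tree) timed" where
  "remove_left a Leaf r = step (a, r)"
| "remove_left a (Node l1 a1 r1) r = do {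
     step ();
     (y, l') \<leftarrow> remove_left a1 l1 r1;
     ret (y, Node r a l')
   }"

fun delete_max :: "'a entry tree \<Rightarrow> 'a entry tree timed" where
  "delete_max Leaf = step Leaf"
| "delete_max (Node Leaf a r) = step r"
| "delete_max (Node (Node l1 a1 r1) a r) = do {
     (y, l') \<leftarrow> remove_left a1 l1 r1;
     sift_down r y l'
   }"


section \<open>Selection of the nearest points\<close>

text \<open>\<open>n\<close> is the current number of entries of the heap \<open>h\<close>; it never exceeds \<open>k\<close>.\<close>

fun fill_heap ::
  "'a::metric_space \<Rightarrow> nat \<Rightarrow> 'a list \<Rightarrow> nat \<Rightarrow> 'a entry tree \<Rightarrow> (nat \<times> 'a entry tree) timed" where
  "fill_heap q k [] n h = step (n, h)"
| "fill_heap q k (p # ps) n h = do {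
     d \<leftarrow> step (dist q p);
     if n < k then do { h' \<leftarrow> heap_insert (d, p) h; fill_heap q k ps (n + 1) h' }
     else if d < fst (value h) then do { h' \<leftarrow> replace_max (d, p) h; fill_heap q k ps n h' }
     else fill_heap q k ps n h
   }"

fun drain_heap :: "nat \<Rightarrow> 'a entry tree \<Rightarrow> 'a entry list \<Rightarrow> 'a entry list timed" where
  "drain_heap 0 h xs = step xs"
| "drain_heap (Suc n) h xs = do {
     x \<leftarrow> step (value h);
     h' \<leftarrow> delete_max h;
     drain_heap n h' (x # xs)
   }"

text \<open>The \<open>k\<close> points of a list nearest to \<open>q\<close> (all of them if there are fewer than \<open>k\<close>), paired with
  their distances and in ascending order of these.\<close>

definition k_nearest :: "'a::metric_space \<Rightarrow> nat \<Rightarrow> 'a list \<Rightarrow> 'a entry list timed" where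
  "k_nearest q k ps = do {
     (n, h) \<leftarrow> fill_heap q k ps 0 Leaf;
     drain_heap n h []
   }"

text \<open>The entry at which the partial sums of the sizes \<open>sz p\<close>, started at \<open>s\<close>, first reach \<open>k\<close>. If
  they never do, no \<open>\<lambda>\<close>-point exists and the result is unspecified.\<close>

fun scan_sizes :: "('a \<Rightarrow> nat) \<Rightarrow> nat \<Rightarrow> nat \<Rightarrow> 'a entry list \<Rightarrow> 'a entry timed" where
  "scan_sizes sz k s [] = step undefined"
| "scan_sizes sz k s (x # xs) = do {
     m \<leftarrow> step (sz (snd x));
     if k \<le> s + m then ret x else scan_sizes sz k (s + m) xs
   }"

definition lambda_point ::
  "'a::metric_space cover_tree \<Rightarrow> 'a \<Rightarrow> nat \<Rightarrow> int \<Rightarrow> 'a list \<Rightarrow> 'a entry timed" where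
  "lambda_point T q k i C = do {
     xs \<leftarrow> k_nearest q k C;
     scan_sizes (\<lambda>p. card (S_set T i p)) k 0 xs
   }"


section \<open>The algorithm\<close>

fun append_timed :: "'a list \<Rightarrow> 'a list \<Rightarrow> 'a list timed" where
  "append_timed [] ys = step ys"
| "append_timed (x # xs) ys = do { step (); zs \<leftarrow> append_timed xs ys; ret (x # zs) }"

text \<open>The given points together with their children of level \<open>i\<close>.\<close>

fun candidates :: "('a \<Rightarrow> int \<Rightarrow> 'a list) \<Rightarrow> int \<Rightarrow> 'a list \<Rightarrow> 'a list timed" where
  "candidates G i [] = step []"
| "candidates G i (p # ps) = do {
     cs \<leftarrow> step (G p i);
     rest \<leftarrow> candidates G i ps;
     zs \<leftarrow> append_timed cs rest;
     ret (p # zs)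
   }"

text \<open>Used only for constant-time tests \<open>Q\<close>, namely comparisons with a fixed real number.\<close>

fun filter_dist ::
  "(real \<Rightarrow> bool) \<Rightarrow> 'a::metric_space \<Rightarrow> 'a list \<Rightarrow> 'a list timed" where
  "filter_dist Q q [] = step []"
| "filter_dist Q q (p # ps) = do {
     d \<leftarrow> step (dist q p);
     rest \<leftarrow> filter_dist Q q ps;
     ret (if Q d then p # rest else rest)
   }"

fun max_Next :: "'a cover_tree \<Rightarrow> int \<Rightarrow> 'a list \<Rightarrow> int \<Rightarrow> int timed" where
  "max_Next T i [] m = step m"
| "max_Next T i (a # as) m = do {
     j \<leftarrow> step (Next T a i);
     max_Next T i as (max j m)
   }"

fun points_of :: "'a entry list \<Rightarrow> 'a list timed" where
  "points_of [] = step []"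
| "points_of (x # xs) = do { step (); ps \<leftarrow> points_of xs; ret (snd x # ps) }"

text \<open>Listing distinctive descendants by a depth-first traversal with a stack of pending tasks.
  \<open>Siblings ps j\<close> stands for all of \<open>S_set T j p\<close> with \<open>p\<close> in \<open>ps\<close>, and \<open>Below p j\<close> for
  \<open>S_set T j p - {p}\<close>, i.e. for the children of \<open>p\<close> of levels less than \<open>j\<close> with all their
  descendants. The traversal stops as soon as \<open>b\<close> points have been listed.\<close>

datatype 'a task = Siblings "'a list" int | Below 'a int

fun task_weight :: "'a cover_tree \<Rightarrow> 'a task \<Rightarrow> nat" where
  "task_weight T (Siblings ps j) = 1"
| "task_weight T (Below p j) = 1 + 2 * nat (j - l_min T + 1)"

function list_descendants ::
  "'a cover_tree \<Rightarrow> ('a \<Rightarrow> int \<Rightarrow> 'a list) \<Rightarrow> nat \<Rightarrow> 'a task list \<Rightarrow> 'a list timed" where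
  "list_descendants T G 0 ts = step []"
| "list_descendants T G (Suc b) [] = step []"
| "list_descendants T G (Suc b) (Siblings [] j # ts) = do {
     step ();
     list_descendants T G (Suc b) ts
   }"
| "list_descendants T G (Suc b) (Siblings (p # ps) j # ts) = do {
     step ();
     us \<leftarrow> list_descendants T G b (Below p j # Siblings ps j # ts);
     ret (p # us)
   }"
| "list_descendants T G (Suc b) (Below p j # ts) = do {
     j' \<leftarrow> step (Next T p j);
     if j' < l_min T then list_descendants T G (Suc b) ts
     else do {
       cs \<leftarrow> step (G p j');
       list_descendants T G (Suc b) (Siblings cs j' # Below p j' # ts)
     }
   }"
  by pat_completeness auto
termination
proof (relation "measures [\<lambda>(T, G, b, ts). b, \<lambda>(T, G, b, ts). sum_list (map (task_weight T) ts)]",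
    goal_cases)
  case (5 T G b p j ts)
  then show ?case using Next_less[of T p j] by auto
qed auto

lemma max_Next_less:
  "l_min T \<le> i \<Longrightarrow> m < i \<Longrightarrow> result (max_Next T i as m) < i"
  by (induction as arbitrary: m) (auto simp: Next_less')

text \<open>The main loop, with \<open>Rs\<close> listing $R_{i^+}$. In the case of an early stop, the two
  \<^const>\<open>Siblings\<close> tasks list the sets \<^const>\<open>S_set\<close> of the points nearer than \<open>\<lambda>\<close> first and then those
  of the points as far as \<open>\<lambda>\<close>, until \<open>k\<close> points are listed.\<close>

function knn_loop ::
  "'a::metric_space cover_tree \<Rightarrow> ('a \<Rightarrow> int \<Rightarrow> 'a list) \<Rightarrow> 'a \<Rightarrow> nat \<Rightarrow> real \<Rightarrow> 'a list \<Rightarrow> int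
    \<Rightarrow> 'a list timed" where
  "knn_loop T G q k \<epsilon> Rs i = do {
     lo \<leftarrow> step (l_min T);
     if i < lo then do { xs \<leftarrow> k_nearest q k Rs; points_of xs }
     else do {
       C \<leftarrow> candidates G i Rs;
       (d, _) \<leftarrow> lambda_point T q k i C;
       Rs' \<leftarrow> filter_dist (\<lambda>x. x \<le> d + 2 powi (i + 2)) q C;
       if 2 powi (i + 2) / \<epsilon> + 2 powi (i + 1) \<le> d
       then do {
         near \<leftarrow> filter_dist (\<lambda>x. x < d) q C;
         ties \<leftarrow> filter_dist (\<lambda>x. x = d) q C;
         list_descendants T G k [Siblings near i, Siblings ties i]
       }
       else do {
         j \<leftarrow> max_Next T i Rs' (lo - 1);
         knn_loop T G q k \<epsilon> Rs' j
       }
     }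
   }"
  by pat_completeness auto
termination
  by (relation "measures [\<lambda>(T, G, q, k, \<epsilon>, Rs, i). nat (i - l_min T + 1)]")
    (auto simp: add1_zle_eq max_Next_less)

definition ApproxkNN ::
  "'a::metric_space cover_tree \<Rightarrow> ('a \<Rightarrow> int \<Rightarrow> 'a list) \<Rightarrow> 'a \<Rightarrow> nat \<Rightarrow> real \<Rightarrow> 'a list timed" where
  "ApproxkNN T G q k \<epsilon> = do {
     i \<leftarrow> step (l_max T - 1);
     knn_loop T G q k \<epsilon> [root T] i
   }"

text \<open>The absolute constant of the time bound. A constant bound by an existential quantifier inside a
  formula could depend on the type \<^typ>\<open>'a\<close>, that is, on the metric space; a closed term cannot. The
  numeral is generous on purpose.\<close>

definition bigO_const :: real where
  "bigO_const = 10 ^ 6"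

end

theory Submission
  imports Defs "HOL-Library.Tree_Multiset"
begin

text \<open>A point \<open>u\<close> lies in \<^term>\<open>S_set T i p\<close> iff \<open>p\<close> is its lowest ancestor of level at least \<open>i\<close>, so
  these sets partition \<open>R\<close> and have radius at most $2^{i+1}$. Hence the \<open>\<lambda>\<close>-point at distance \<open>d\<close> shows
  that the $k$-th neighbor is no farther than $d + 2^{i+1}$, and discarding the candidates farther than
  $d + 2^{i+2}$ never loses a point of the \<open>k\<close> neighborhoods. On an early stop, a missed neighbor \<open>u\<close> and
  a superfluous output point \<open>p\<close> have distances at least $d - 2^{i+1}$ and at most $d + 2^{i+1}$, whose
  ratio is at most $1 + \epsilon$ by the stopping criterion.

  If the loop goes on, the new $R_i$ is a $2^i$-sparse subset of the ball of radius
  $2^i (4 / \epsilon + 6)$, so a packing argument bounds its size by $c_m^{4 + \lceil \log_2 (2 + 1/\epsilon) \rceil}$; the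
  children of one level contribute another factor $c_m^4$. The number of rounds is at most
  $l_{max} - l_{min}$, which is $O(\log_2 \Delta)$.\<close>

section \<open>Packing and the minimized expansion constant\<close>

text \<open>The infimum in \<open>c_m\<close> need not be attained, and a near-optimal
  \<open>A\<close> depends on the scale. Packing therefore works in some \<open>A\<close> with
  constant \<open>c_m R + \<eta>\<close> for radii above a fraction of the sparsity, and
  \<open>\<eta>\<close> tends to 0 once \<open>A\<close> has left the estimate. Doubling is
  available only at points of \<open>A\<close>, and \<open>q\<close> need not be one; hence balls
  are recentered at a point of the packed set, at the price of replacing the radius of the region by
  its double.

  The size bound does not accumulate over the rounds, because every failed stopping test bounds the
  distance of the \<lambda>-point anew by a multiple of \<open>2 powi i\<close>. Skipped levels do
  no harm, as no child of a retained point lies in them.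

  The factor logarithmic in \<open>k\<close> comes from the heaps alone. The summand
  \<open>k\<close> is paid once, for listing descendants on an early stop, at amortized constant
  cost per listed point.\<close>

lemma card_cball_pos:
  "p \<in> A \<Longrightarrow> 0 \<le> t \<Longrightarrow> finite (cball p t \<inter> A) \<Longrightarrow> 0 < card (cball p t \<inter> A)"
  by (metis IntI card_gt_0_iff centre_in_cball empty_iff)

definition expansion :: "'a::metric_space set \<Rightarrow> real \<Rightarrow> ereal" where
  "expansion R \<xi> = (INF A \<in> {A. R \<subseteq> A \<and> loc_finite A}.
       SUP (p, t) \<in> {(p, t). p \<in> A \<and> \<xi> < t}.
         ereal (real (card (cball p (2 * t) \<inter> A)) / real (card (cball p t \<inter> A))))"

lemma expansion_antimono: "\<xi> \<le> \<xi>' \<Longrightarrow> expansion R \<xi>' \<le> expansion R \<xi>"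
  unfolding expansion_def
  by (rule INF_mono, rule bexI, rule SUP_subset_mono) auto

text \<open>An antitone function on the positive reals tends to its supremum at 0. This replaces the
  limit by an order-theoretic bound that is valid at every scale \<open>\<xi>\<close>.\<close>

lemma c_m_eq_SUP:
  fixes R :: "'a::metric_space set"
  shows "c_m R = real_of_ereal (SUP \<xi>\<in>{0<..}. expansion R \<xi>)"
proof -
  have "(expansion R \<longlongrightarrow> (SUP \<xi>\<in>{0<..}. expansion R \<xi>)) (at_right 0)"
  proof (rule order_tendstoI)
    fix a assume "a < (SUP \<xi>\<in>{0<..}. expansion R \<xi>)"
    then obtain \<xi>0 where "\<xi>0 > 0" "a < expansion R \<xi>0" by (auto simp: less_SUP_iff)
    then show "\<forall>\<^sub>F \<xi> in at_right 0. a < expansion R \<xi>"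
      unfolding eventually_at_right[OF zero_less_one]
      by (meson expansion_antimono less_imp_le less_le_trans)
  next
    fix a assume a: "(SUP \<xi>\<in>{0<..}. expansion R \<xi>) < a"
    show "\<forall>\<^sub>F \<xi> in at_right 0. expansion R \<xi> < a"
      unfolding eventually_at_right[OF zero_less_one]
      by (metis SUP_upper a greaterThan_iff le_less_trans zero_less_one)
  qed
  then have "Lim (at_right 0) (expansion R) = (SUP \<xi>\<in>{0<..}. expansion R \<xi>)"
    by (intro tendsto_Lim) auto
  then show ?thesis
    unfolding c_m_def expansion_def[abs_def] by simp
qed

context
  fixes R :: "'a::metric_space set"
  assumes fin: "finite R" and nonempty: "R \<noteq> {}"
begin

text \<open>The choice \<open>A = R\<close> gives numerators at most \<open>card R\<close> over
  denominators at least 1. With the lower bound 1 below, the supremum is finite, so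
  \<open>real_of_ereal\<close> in \<open>c_m\<close> loses nothing.\<close>

lemma expansion_le_card: "expansion R \<xi> \<le> ereal (card R)" if "\<xi> > 0"
proof -
  have "expansion R \<xi> \<le> (SUP (p, t) \<in> {(p, t). p \<in> R \<and> \<xi> < t}.
         ereal (real (card (cball p (2 * t) \<inter> R)) / real (card (cball p t \<inter> R))))"
    unfolding expansion_def by (rule INF_lower) (auto simp: loc_finite_def fin)
  also have "\<dots> \<le> ereal (card R)"
  proof (rule SUP_least, clarsimp)
    fix p t assume "p \<in> R" "\<xi> < t"
    have "0 < card (cball p t \<inter> R)"
      using \<open>p \<in> R\<close> \<open>\<xi> < t\<close> that fin by (intro card_cball_pos) auto
    moreover have "card (cball p (2 * t) \<inter> R) \<le> card R"
      by (simp add: card_mono fin)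
    ultimately show "real (card (cball p (2 * t) \<inter> R)) / real (card (cball p t \<inter> R)) \<le> real (card R)"
      by (simp add: divide_le_eq mult_le_cancel_left1 order_trans)
        (metis le_trans mult_le_mono2 mult.right_neutral One_nat_def Suc_leI of_nat_le_iff of_nat_mult)
  qed
  finally show ?thesis .
qed

lemma expansion_ge_1: "1 \<le> expansion R \<xi>" if "\<xi> > 0"
  unfolding expansion_def
proof (rule INF_greatest)
  fix A assume "A \<in> {A. R \<subseteq> A \<and> loc_finite A}"
  then have A: "R \<subseteq> A" "loc_finite A" by auto
  obtain p where p: "p \<in> A" using nonempty A by auto
  have fin': "finite (cball p r \<inter> A)" if "r \<ge> 0" for r
    using A that by (auto simp: loc_finite_def)
  have "0 < card (cball p (\<xi>+1) \<inter> A)"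
    using p fin'[of "\<xi>+1"] that by (intro card_cball_pos) auto
  moreover have "card (cball p (\<xi>+1) \<inter> A) \<le> card (cball p (2*(\<xi>+1)) \<inter> A)"
    by (rule card_mono) (use fin'[of "2*(\<xi>+1)"] that in auto)
  ultimately have "1 \<le> ereal (real (card (cball p (2 * (\<xi>+1)) \<inter> A)) / real (card (cball p (\<xi>+1) \<inter> A)))"
    by (simp add: le_divide_eq flip: one_ereal_def)
  then show "1 \<le> (SUP (p, t) \<in> {(p, t). p \<in> A \<and> \<xi> < t}.
         ereal (real (card (cball p (2 * t) \<inter> A)) / real (card (cball p t \<inter> A))))"
    by (intro SUP_upper2[of "(p, \<xi>+1)"]) (use p in auto)
qed

lemma ereal_c_m: "ereal (c_m R) = (SUP \<xi>\<in>{0<..}. expansion R \<xi>)"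
proof -
  have "(SUP \<xi>\<in>{0<..}. expansion R \<xi>) \<le> ereal (card R)"
    by (rule SUP_least) (auto intro: expansion_le_card)
  moreover have "1 \<le> (SUP \<xi>\<in>{0<..}. expansion R \<xi>)"
    by (rule SUP_upper2[of 1]) (auto intro: expansion_ge_1)
  ultimately show ?thesis unfolding c_m_eq_SUP
    by (intro ereal_real') auto
qed

lemma expansion_le_c_m: "\<xi> > 0 \<Longrightarrow> expansion R \<xi> \<le> ereal (c_m R)"
  unfolding ereal_c_m by (rule SUP_upper) auto

lemma c_m_ge_1: "1 \<le> c_m R"
  using expansion_ge_1[of 1] expansion_le_c_m[of 1] order_trans
  by (metis ereal_less_eq(3) one_ereal_def zero_less_one)

text \<open>The slack \<open>\<eta>\<close> is what yields an actual \<open>A\<close> from an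
  infimum. The same \<open>A\<close> serves all centers and all radii above \<open>\<xi>\<close>, so
  doubling can be iterated.\<close>

lemma ex_doubling_superset:
  assumes "\<eta> > 0" "\<xi> > 0"
  obtains A where "R \<subseteq> A" "loc_finite A"
    "\<And>p t. p \<in> A \<Longrightarrow> \<xi> < t \<Longrightarrow>
       real (card (cball p (2 * t) \<inter> A)) \<le> (c_m R + \<eta>) * real (card (cball p t \<inter> A))"
proof -
  have "expansion R \<xi> < ereal (c_m R + \<eta>)"
    by (rule le_less_trans[OF expansion_le_c_m[OF assms(2)]]) (use assms(1) in simp)
  then obtain A where A: "R \<subseteq> A" "loc_finite A" and
    *: "(SUP (p, t) \<in> {(p, t). p \<in> A \<and> \<xi> < t}.
         ereal (real (card (cball p (2 * t) \<inter> A)) / real (card (cball p t \<inter> A)))) < ereal (c_m R + \<eta>)"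
    unfolding expansion_def INF_less_iff by auto
  show thesis
  proof (rule that[OF A])
    fix p t assume p: "p \<in> A" "\<xi> < t"
    have pos: "0 < card (cball p t \<inter> A)"
      using p A assms(2) by (intro card_cball_pos) (auto simp: loc_finite_def)
    have "ereal (real (card (cball p (2 * t) \<inter> A)) / real (card (cball p t \<inter> A)))
       \<le> (SUP (p, t) \<in> {(p, t). p \<in> A \<and> \<xi> < t}.
         ereal (real (card (cball p (2 * t) \<inter> A)) / real (card (cball p t \<inter> A))))"
      by (rule SUP_upper2[of "(p, t)"]) (use p in auto)
    also note *
    finally show "real (card (cball p (2 * t) \<inter> A)) \<le> (c_m R + \<eta>) * real (card (cball p t \<inter> A))"
      using pos by (simp add: divide_less_eq)
  qed
qed

text \<open>The balls of radius \<open>\<delta> / 2\<close> about the points of \<open>S\<close> are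
  disjoint, and all lie in the ball of radius \<open>2 ^ n * (\<delta> / 2)\<close> about any one of
  them. Centered at the point \<open>p\<close> whose small ball meets \<open>A\<close> in the fewest
  points, the large ball contains at least \<open>card S * g p\<close> points of \<open>A\<close>,
  and by \<open>n\<close> doublings at most \<open>(c_m R + \<eta>) ^ n * g p\<close>.\<close>

lemma card_packing_eps:
  assumes S: "S \<subseteq> R" "S \<subseteq> cball q t" "\<And>x y. x \<in> S \<Longrightarrow> y \<in> S \<Longrightarrow> x \<noteq> y \<Longrightarrow> \<delta> < dist x y"
    and "\<delta> > 0" and n: "4 * t / \<delta> + 1 \<le> 2 ^ n" and "\<eta> > 0"
  shows "real (card S) \<le> (c_m R + \<eta>) ^ n"
proof (cases "S = {}")
  case True
  then show ?thesis using c_m_ge_1 \<open>\<eta> > 0\<close> by simp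
next
  case False
  have finS: "finite S" using S(1) fin finite_subset by blast
  \<comment> \<open>The smallest radius to be doubled is \<open>\<delta> / 2\<close>; the threshold
    only has to be positive and strictly below it.\<close>
  obtain A where A: "R \<subseteq> A" "loc_finite A" and
    dbl: "\<And>p t. p \<in> A \<Longrightarrow> \<delta> / 4 < t \<Longrightarrow>
       real (card (cball p (2 * t) \<inter> A)) \<le> (c_m R + \<eta>) * real (card (cball p t \<inter> A))"
    using ex_doubling_superset[of \<eta> "\<delta> / 4"] assms by auto
  have finA: "finite (cball p r \<inter> A)" for p r
    using A by (cases "r \<ge> 0") (auto simp: loc_finite_def)
  have iter: "real (card (cball p (2 ^ m * (\<delta> / 2)) \<inter> A)) \<le> (c_m R + \<eta>) ^ m * real (card (cball p (\<delta> / 2) \<inter> A))"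
    if "p \<in> A" for p m
  proof (induction m)
    case (Suc m)
    have "\<delta> / 4 < 2 ^ m * (\<delta> / 2)"
    proof -
      have "1 * (\<delta> / 2) \<le> 2 ^ m * (\<delta> / 2)"
        using \<open>\<delta> > 0\<close> by (intro mult_right_mono) auto
      then show ?thesis using \<open>\<delta> > 0\<close> by linarith
    qed
    from dbl[OF that this]
    have "real (card (cball p (2 ^ Suc m * (\<delta> / 2)) \<inter> A))
       \<le> (c_m R + \<eta>) * real (card (cball p (2 ^ m * (\<delta> / 2)) \<inter> A))" by (simp add: mult.assoc)
    also have "\<dots> \<le> (c_m R + \<eta>) * ((c_m R + \<eta>) ^ m * real (card (cball p (\<delta> / 2) \<inter> A)))"
      using c_m_ge_1 \<open>\<eta> > 0\<close> by (intro mult_left_mono Suc) auto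
    finally show ?case by simp
  qed simp
  define g where "g = (\<lambda>p. card (cball p (\<delta> / 2) \<inter> A))"
  obtain p where p: "p \<in> S" and pmin: "\<And>s. s \<in> S \<Longrightarrow> g p \<le> g s"
    using False finS by (metis arg_min_if_finite(1) arg_min_least)
  have gp: "g p > 0"
    unfolding g_def using p S(1) A(1) finA \<open>\<delta> > 0\<close> by (intro card_cball_pos) auto
  have disj: "(cball x (\<delta>/2) \<inter> A) \<inter> (cball y (\<delta>/2) \<inter> A) = {}" if "x \<in> S" "y \<in> S" "x \<noteq> y" for x y
  proof -
    have False if "dist x z \<le> \<delta>/2" "dist y z \<le> \<delta>/2" for z
      using S(3)[OF \<open>x \<in> S\<close> \<open>y \<in> S\<close> \<open>x \<noteq> y\<close>] that dist_triangle2[of x y z] by linarith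
    then show ?thesis by auto
  qed
  have "card S * g p \<le> (\<Sum>s\<in>S. g s)"
    using sum_mono[of S "\<lambda>_. g p" g] pmin by simp
  also have "\<dots> = card (\<Union>s\<in>S. cball s (\<delta>/2) \<inter> A)"
    unfolding g_def by (rule card_UN_disjoint[symmetric]) (use finS finA disj in auto)
  also have "\<dots> \<le> card (cball p (2 ^ n * (\<delta> / 2)) \<inter> A)"
  proof (rule card_mono[OF finA], clarsimp)
    fix s x assume "s \<in> S" "dist s x * 2 \<le> \<delta>"
    moreover have "dist p x \<le> dist p q + dist q s + dist s x"
      by (meson add_mono_thms_linordered_semiring(3) dist_triangle order_trans)
    moreover have "dist p q \<le> t" "dist q s \<le> t"
      using S(2) p \<open>s \<in> S\<close> by (auto simp: dist_commute)
    ultimately have "dist p x \<le> 2 * t + \<delta> / 2" by linarith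
    also have "\<dots> = (4 * t / \<delta> + 1) * (\<delta> / 2)" using \<open>\<delta> > 0\<close> by (simp add: field_simps)
    also have "\<dots> \<le> 2 ^ n * (\<delta> / 2)" using n \<open>\<delta> > 0\<close> by (intro mult_right_mono) auto
    finally show "dist p x * 2 \<le> 2 ^ n * \<delta>" by simp
  qed
  finally have "real (card S) * real (g p) \<le> real (card (cball p (2 ^ n * (\<delta> / 2)) \<inter> A))"
    by (metis of_nat_le_iff of_nat_mult)
  also have "\<dots> \<le> (c_m R + \<eta>) ^ n * real (g p)"
    unfolding g_def by (rule iter) (use p S A in auto)
  finally show ?thesis using gp by simp
qed

text \<open>The set \<open>A\<close> changes with \<open>\<eta>\<close>, but the bound no longer
  mentions it, so \<open>\<eta>\<close> may tend to 0.\<close>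

lemma card_packing:
  assumes "S \<subseteq> R" "S \<subseteq> cball q t" "\<And>x y. x \<in> S \<Longrightarrow> y \<in> S \<Longrightarrow> x \<noteq> y \<Longrightarrow> \<delta> < dist x y"
    and "\<delta> > 0" and "4 * t / \<delta> + 1 \<le> 2 ^ n"
  shows "real (card S) \<le> c_m R ^ n"
proof (rule tendsto_lowerbound)
  show "((\<lambda>\<eta>. (c_m R + \<eta>) ^ n) \<longlongrightarrow> c_m R ^ n) (at_right 0)"
    by (rule tendsto_eq_intros refl | simp)+
  show "\<forall>\<^sub>F \<eta> in at_right 0. real (card S) \<le> (c_m R + \<eta>) ^ n"
    unfolding eventually_at_right[OF zero_less_one]
    using card_packing_eps[OF assms] zero_less_one by blast
qed simp

end

section \<open>Nearest neighbors\<close>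

text \<open>Turns counting points of \<open>R\<close> by distance into counting list entries.
  Equality holds because \<open>sorted_dists\<close> keeps multiplicities.\<close>

lemma card_dist_filter:
  assumes "finite R"
  shows "card {u \<in> R. Q (dist q u)} = length (filter Q (sorted_dists q R))"
proof -
  have "length (filter Q (sorted_dists q R)) = size (filter_mset Q (image_mset (dist q) (mset_set R)))"
    unfolding sorted_dists_def by (metis mset_filter mset_sorted_list_of_multiset size_mset)
  also have "\<dots> = card {u \<in> R. Q (dist q u)}"
    using assms by (simp add: filter_mset_image_mset filter_mset_mset_set)
  finally show ?thesis by simp
qed

lemma length_sorted_dists: "length (sorted_dists q R) = card R"
  unfolding sorted_dists_def by (metis mset_sorted_list_of_multiset size_image_mset size_mset size_mset_set)

lemma sorted_sorted_dists: "sorted (sorted_dists q R)"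
  by (simp add: sorted_dists_def)

context
  fixes R :: "'a::metric_space set" and k :: nat
  assumes fin: "finite R" and k: "1 \<le> k" "k \<le> card R"
begin

lemma NN_upto_eq: "NN_upto R q k = {u \<in> R. dist q u \<le> sorted_dists q R ! (k - 1)}"
proof -
  have "sorted_dists q R ! (i - 1) \<le> sorted_dists q R ! (k - 1)" if "i \<in> {1..k}" for i
    using that k by (intro sorted_nth_mono sorted_sorted_dists) (auto simp: length_sorted_dists)
  then show ?thesis using k unfolding NN_upto_def NN_def by (fastforce intro: order_trans)
qed

text \<open>The first \<open>k\<close> entries of a sorted list do not exceed the
  \<open>k\<close>-th. Ties at that distance can make the inequality strict.\<close>

lemma card_NN_upto: "k \<le> card (NN_upto R q k)"
proof -
  let ?xs = "sorted_dists q R" let ?v = "?xs ! (k - 1)"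
  have "x \<le> ?v" if x: "x \<in> set (take k ?xs)" for x
  proof -
    obtain i where "i < k" "x = ?xs ! i"
      using x by (auto simp: in_set_conv_nth)
    then show ?thesis using k
      by (auto simp: length_sorted_dists intro!: sorted_nth_mono sorted_sorted_dists)
  qed
  then have "filter (\<lambda>x. x \<le> ?v) (take k ?xs) = take k ?xs" by simp
  then have "length (filter (\<lambda>x. x \<le> ?v) (take k ?xs @ drop k ?xs)) \<ge> k"
    unfolding filter_append using k by (simp add: length_sorted_dists)
  then show ?thesis unfolding NN_upto_eq using card_dist_filter[OF fin, of "\<lambda>x. x \<le> ?v" q] by simp
qed

text \<open>If the \<open>k\<close>-th distance exceeded \<open>r\<close>, at most
  \<open>k - 1\<close> entries of the sorted list could be at most \<open>r\<close>, too few for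
  \<open>X\<close>. Thus any \<open>k\<close> points within \<open>r\<close> certify a bound on all
  the \<open>k\<close> neighborhoods.\<close>

lemma NN_upto_dist_le:
  assumes "X \<subseteq> R" "k \<le> card X" "\<And>x. x \<in> X \<Longrightarrow> dist q x \<le> r" "u \<in> NN_upto R q k"
  shows "dist q u \<le> r"
proof (rule ccontr)
  assume far: "\<not> dist q u \<le> r"
  let ?xs = "sorted_dists q R"
  have r: "r < ?xs ! (k - 1)" using assms(4) far by (auto simp: NN_upto_eq)
  have "\<not> x \<le> r" if x: "x \<in> set (drop (k - 1) ?xs)" for x
  proof -
    obtain i where i: "i < length ?xs - (k - 1)" "x = ?xs ! (k - 1 + i)"
      using x by (auto simp: in_set_conv_nth)
    then have "?xs ! (k - 1) \<le> x"
      by (auto intro!: sorted_nth_mono sorted_sorted_dists)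
    then show ?thesis using r by simp
  qed
  then have "filter (\<lambda>x. x \<le> r) (drop (k - 1) ?xs) = []" by (simp add: filter_empty_conv)
  then have "length (filter (\<lambda>x. x \<le> r) (take (k - 1) ?xs @ drop (k - 1) ?xs)) \<le> k - 1"
    unfolding filter_append
    by simp (metis length_filter_le length_take min.cobounded2 order_trans)
  then have "card {u \<in> R. dist q u \<le> r} \<le> k - 1"
    using card_dist_filter[OF fin, of "\<lambda>x. x \<le> r" q] by simp
  moreover have "card X \<le> card {u \<in> R. dist q u \<le> r}"
    by (rule card_mono) (use assms fin in auto)
  ultimately show False using assms(2) k by linarith
qed

lemma approx_knn_setI:
  assumes P: "P \<subseteq> R" "card P = k" and "0 < \<epsilon>"
    and *: "\<And>p u. p \<in> P - NN_upto R q k \<Longrightarrow> u \<in> NN_upto R q k - P \<Longrightarrow> dist q p \<le> (1 + \<epsilon>) * dist q u"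
  shows "approx_knn_set R q k \<epsilon> P"
proof -
  let ?N = "NN_upto R q k"
  have finN: "finite ?N" using fin by (simp add: NN_upto_eq)
  have finP: "finite P" using P fin finite_subset by blast
  have "card (P - ?N) = card P - card (P \<inter> ?N)" "card (?N - P) = card ?N - card (P \<inter> ?N)"
    using finP finN by (simp_all add: card_Diff_subset_Int inf_commute)
  then have "card (P - ?N) \<le> card (?N - P)" using P card_NN_upto[of q] by linarith
  then obtain f where f: "inj_on f (P - ?N)" "f ` (P - ?N) \<subseteq> ?N - P"
    using card_le_inj[of "P - ?N" "?N - P"] finP finN by auto
  define g where "g = (\<lambda>p. if p \<in> ?N then p else f p)"
  have "inj_on g P"
    using f unfolding g_def inj_on_def by (auto split: if_splits)
  moreover have "g ` P \<subseteq> ?N" using f by (auto simp: g_def)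
  moreover have "dist q p \<le> (1 + \<epsilon>) * dist q (g p)" if "p \<in> P" for p
  proof (cases "p \<in> ?N")
    case True
    then show ?thesis using \<open>0 < \<epsilon>\<close> by (simp add: g_def mult_le_cancel_right1)
  next
    case False
    then show ?thesis using * f that by (auto simp: g_def)
  qed
  ultimately show ?thesis unfolding approx_knn_set_def using P by blast
qed

end

section \<open>Binary heaps\<close>

fun braun :: "'b tree \<Rightarrow> bool" where
  "braun Leaf \<longleftrightarrow> True"
| "braun (Node l x r) \<longleftrightarrow> (size l = size r \<or> size l = size r + 1) \<and> braun l \<and> braun r"

text \<open>Subtree sizes differ by at most one, with the left one the larger, so twice the size of
  either subtree is at most the size of the whole tree: sizes at least halve with every
  level.\<close>

lemma braun_height: "braun t \<Longrightarrow> t \<noteq> Leaf \<Longrightarrow> 2 ^ height t \<le> 2 * size t"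
proof (induction t)
  case (Node l x r)
  have "2 * 2 ^ height l \<le> 2 * (1 + size l + size r)"
    using Node by (cases "l = Leaf") auto
  moreover have "2 * 2 ^ height r \<le> 2 * (1 + size l + size r)"
    using Node by (cases "r = Leaf") auto
  ultimately show ?case by (simp add: max_def)
qed simp

text \<open>The order involves distances only, since the points inside the entries carry no
  order.\<close>

fun fst_heap :: "'a entry tree \<Rightarrow> bool" where
  "fst_heap Leaf \<longleftrightarrow> True"
| "fst_heap (Node l x r) \<longleftrightarrow>
     (\<forall>y \<in> set_tree l. fst y \<le> fst x) \<and> (\<forall>y \<in> set_tree r. fst y \<le> fst x) \<and> fst_heap l \<and> fst_heap r"

lemma fst_heap_value: "fst_heap h \<Longrightarrow> y \<in> set_tree h \<Longrightarrow> fst y \<le> fst (value h)"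
  by (cases h) auto

lemma heap_insert_mset: "mset_tree (result (heap_insert x t)) = add_mset x (mset_tree t)"
  by (induction x t rule: heap_insert.induct) auto

lemma heap_insert_set: "set_tree (result (heap_insert x t)) = insert x (set_tree t)"
  by (metis heap_insert_mset set_mset_add_mset_insert set_mset_tree)

lemma heap_insert_size: "size (result (heap_insert x t)) = Suc (size t)"
  by (metis heap_insert_mset size_add_mset size_mset_tree)

lemma heap_insert_braun: "braun t \<Longrightarrow> braun (result (heap_insert x t))"
  by (induction x t rule: heap_insert.induct) (auto simp: heap_insert_size)

lemma heap_insert_heap: "fst_heap t \<Longrightarrow> fst_heap (result (heap_insert x t))"
proof (induction x t rule: heap_insert.induct)
  case (2 x l a r)
  have "fst y \<le> max (fst x) (fst a)" if "y \<in> set_tree l \<union> set_tree r" for y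
    using 2(3) that by (auto simp: max.coboundedI2)
  then show ?case using 2 by (cases "fst a \<le> fst x") (simp_all add: heap_insert_set)
qed simp

lemma heap_insert_time: "time (heap_insert x t) \<le> height t + 1"
  by (induction x t rule: heap_insert.induct) (auto simp: max_def)

lemma sift_down_mset:
  "size l = size r \<or> size l = size r + 1 \<Longrightarrow> braun l \<Longrightarrow> braun r \<Longrightarrow>
   mset_tree (result (sift_down l x r)) = add_mset x (mset_tree l + mset_tree r)"
  by (induction l x r rule: sift_down.induct) auto

lemma sift_down_braun:
  "size l = size r \<or> size l = size r + 1 \<Longrightarrow> braun l \<Longrightarrow> braun r \<Longrightarrow>
   braun (result (sift_down l x r)) \<and> size (result (sift_down l x r)) = Suc (size l + size r)"
  by (induction l x r rule: sift_down.induct) auto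

lemma sift_down_set:
  assumes "size l = size r \<or> size l = size r + 1" "braun l" "braun r"
  shows "set_tree (result (sift_down l x r)) = insert x (set_tree l \<union> set_tree r)"
  using arg_cong[OF sift_down_mset[OF assms, of x], of set_mset] by simp

text \<open>With an empty left subtree \<open>sift_down\<close> never compares \<open>x\<close> with
  \<open>r\<close>; the balance hypothesis makes \<open>r\<close> empty then.\<close>

lemma sift_down_heap:
  "size l = size r \<or> size l = size r + 1 \<Longrightarrow> braun l \<Longrightarrow> braun r \<Longrightarrow> fst_heap l \<Longrightarrow> fst_heap r \<Longrightarrow>
   fst_heap (result (sift_down l x r))"
proof (induction l x r rule: sift_down.induct)
  case (2 l1 a1 r1 x)
  have "\<forall>y\<in>set_tree l1 \<union> set_tree r1. fst y \<le> max (fst x) (fst a1)"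
    using 2(5) by (simp add: max.coboundedI2 ball_Un)
  then show ?case using 2 by (cases "fst a1 \<le> fst x") (simp_all add: sift_down_set ball_Un)
next
  case (3 l1 a1 r1 x l2 a2 r2)
  let ?m = "max (fst x) (max (fst a1) (fst a2))"
  have m: "\<forall>y\<in>set_tree l1 \<union> set_tree r1. fst y \<le> ?m" "\<forall>y\<in>set_tree l2 \<union> set_tree r2. fst y \<le> ?m"
    using 3 by (simp_all add: max.coboundedI2 max.coboundedI1 ball_Un)
  have s: "size l1 = size r1 \<or> size l1 = size r1 + 1" "size l2 = size r2 \<or> size l2 = size r2 + 1"
    "braun l1" "braun l2" "braun r1" "braun r2" using 3 by simp_all
  consider "fst a1 \<le> fst x \<and> fst a2 \<le> fst x"
    | "\<not> (fst a1 \<le> fst x \<and> fst a2 \<le> fst x)" "fst a2 \<le> fst a1"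
    | "\<not> (fst a1 \<le> fst x \<and> fst a2 \<le> fst x)" "\<not> fst a2 \<le> fst a1" by blast
  then show ?case
  proof cases
    case 1
    then have "?m = fst x" by simp
    then show ?thesis using 1 3 m by (simp add: ball_Un)
  next
    case 2
    then have "?m = fst a1" "fst x \<le> fst a1" by linarith+
    then show ?thesis using 2 3 s m by (simp add: ball_Un sift_down_set)
  next
    case c: 3
    then have "?m = fst a2" "fst x < fst a2" by linarith+
    then show ?thesis using c 3 s m by (simp add: ball_Un sift_down_set)
  qed
qed simp

lemma sift_down_time: "time (sift_down l x r) \<le> height (Node l x r)"
  by (induction l x r rule: sift_down.induct) auto

lemma remove_left_mset:
  "result (remove_left a l r) = (y, t) \<Longrightarrow> add_mset y (mset_tree t) = add_mset a (mset_tree l + mset_tree r)"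
  by (induction a l r arbitrary: y t rule: remove_left.induct) (force split: prod.splits)+

lemma remove_left_size:
  "result (remove_left a l r) = (y, t) \<Longrightarrow> size t = size l + size r"
  using remove_left_mset[of a l r y t] size_mset_tree
  by (metis add_mset_add_single size_union add_right_cancel size_add_mset Suc_inject)

lemma remove_left_braun:
  "braun (Node l a r) \<Longrightarrow> result (remove_left a l r) = (y, t) \<Longrightarrow> braun t"
proof (induction a l r arbitrary: y t rule: remove_left.induct)
  case (2 a l1 a1 r1 r)
  obtain y' l' where l': "result (remove_left a1 l1 r1) = (y', l')" by (cases "result (remove_left a1 l1 r1)")
  then show ?case using 2 remove_left_size[OF l'] by auto
qed auto

lemma remove_left_heap:
  "fst_heap (Node l a r) \<Longrightarrow> result (remove_left a l r) = (y, t) \<Longrightarrow> fst_heap t"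
proof (induction a l r arbitrary: y t rule: remove_left.induct)
  case (2 a l1 a1 r1 r)
  obtain y' l' where l': "result (remove_left a1 l1 r1) = (y', l')" by (cases "result (remove_left a1 l1 r1)")
  have "set_tree l' \<subseteq> insert a1 (set_tree l1 \<union> set_tree r1)"
    using arg_cong[OF remove_left_mset[OF l'], of set_mset] by auto
  moreover have "\<forall>y\<in>insert a1 (set_tree l1 \<union> set_tree r1). fst y \<le> fst a"
    using 2(2) by simp
  ultimately have "\<forall>y\<in>set_tree l'. fst y \<le> fst a" by blast
  moreover have "t = Node r a l'" using 2(3) l' by simp
  ultimately show ?case using 2 l' by simp
qed auto

lemma remove_left_time: "time (remove_left a l r) \<le> height l + 1"
  by (induction a l r rule: remove_left.induct) (auto split: prod.splits simp: max_def)

lemma remove_left_height: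
  "result (remove_left a l r) = (y, t) \<Longrightarrow> height t \<le> height (Node l a r)"
proof (induction a l r arbitrary: y t rule: remove_left.induct)
  case (2 a l1 a1 r1 r)
  obtain y' l' where l': "result (remove_left a1 l1 r1) = (y', l')" by (cases "result (remove_left a1 l1 r1)")
  then show ?case using 2 by (auto simp: max_def)
qed auto

lemma delete_max_props:
  assumes "braun h" "fst_heap h" "h \<noteq> Leaf"
  shows "braun (result (delete_max h)) \<and> fst_heap (result (delete_max h)) \<and>
    add_mset (value h) (mset_tree (result (delete_max h))) = mset_tree h \<and>
    time (delete_max h) \<le> 2 * height h + 1"
proof (cases h rule: delete_max.cases)
  case (3 l1 a1 r1 a r)
  obtain y l' where l': "result (remove_left a1 l1 r1) = (y, l')" by (cases "result (remove_left a1 l1 r1)")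
  have b: "braun l'" "fst_heap l'" "size l' = size l1 + size r1"
    using remove_left_braun[OF _ l'] remove_left_heap[OF _ l'] remove_left_size[OF l'] assms 3 by auto
  \<comment> \<open>The left subtree has lost exactly one entry, so after the exchange
    \<open>r\<close> can take the role of the left sibling.\<close>
  have s: "size r = size l' \<or> size r = size l' + 1" using assms 3 b by auto
  have "time (delete_max h) = time (remove_left a1 l1 r1) + time (sift_down r y l')"
    using 3 l' by simp
  also have "\<dots> \<le> height l1 + 1 + height (Node r y l')"
    using remove_left_time sift_down_time add_mono by blast
  also have "height l1 + 1 \<le> height h" using 3 by simp
  also have "height (Node r y l') \<le> height h + 1"
    using 3 remove_left_height[OF l'] by (simp add: max_def)
  finally have t: "time (delete_max h) \<le> 2 * height h + 1" by simp
  have m: "add_mset a (mset_tree (result (delete_max h))) = mset_tree h"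
    using 3 l' assms b sift_down_mset[OF s, of y] remove_left_mset[OF l'] by simp
  have "braun (result (delete_max h))" "fst_heap (result (delete_max h))"
    using 3 l' assms b sift_down_braun[OF s, of y] sift_down_heap[OF s, of y] by simp_all
  then show ?thesis using t m 3 by simp
qed (use assms in auto)

section \<open>Logarithmic heap height and selection of the nearest points\<close>

definition heap_height :: "nat \<Rightarrow> nat" where
  "heap_height k = 1 + nat \<lfloor>log 2 (real k)\<rfloor>"

text \<open>For positive \<open>k\<close>, \<open>heap_height k\<close> is the height of a Braun
  tree with exactly \<open>k\<close> entries.\<close>

lemma height_le_heap_height:
  assumes "braun h" "size h \<le> k"
  shows "height h \<le> heap_height k"
proof (cases "h = Leaf")
  case False
  then have k: "k > 0" using assms by (cases h) auto
  have "(2::nat) ^ height h \<le> 2 * k"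
    using braun_height[OF assms(1) False] assms(2) by linarith
  then have "(2::real) ^ height h \<le> 2 * real k"
    by (metis (mono_tags, lifting) of_nat_le_iff of_nat_mult of_nat_numeral of_nat_power)
  then have "real (height h) \<le> log 2 (2 * real k)"
    using k by (simp add: le_log_of_power)
  also have "\<dots> = 1 + log 2 (real k)" using k by (simp add: log_mult)
  finally have "int (height h) - 1 \<le> \<lfloor>log 2 (real k)\<rfloor>" by (simp add: le_floor_iff)
  then show ?thesis unfolding heap_height_def by linarith
qed simp

text \<open>\<open>D\<close> is a ghost multiset of the entries discarded so far, \<open>D'\<close>
  its final value. Nothing discarded is nearer than anything kept. Nothing is discarded before the
  heap is full, so an insertion, which could break this order, only happens while \<open>D\<close>
  is empty.\<close>

lemma fill_heap_props:
  assumes "1 \<le> k" "braun h" "fst_heap h" "size h = n" "n \<le> k"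
    and "\<forall>x\<in>set_tree h. \<forall>y\<in>#D. fst x \<le> fst y" "D = {#} \<or> n = k"
  shows "braun (snd (result (fill_heap q k ps n h))) \<and> fst_heap (snd (result (fill_heap q k ps n h))) \<and>
    size (snd (result (fill_heap q k ps n h))) = fst (result (fill_heap q k ps n h)) \<and>
    fst (result (fill_heap q k ps n h)) = min k (n + length ps) \<and>
    time (fill_heap q k ps n h) \<le> length ps * (heap_height k + 2) + 1 \<and>
    (\<exists>D'. mset_tree (snd (result (fill_heap q k ps n h))) + D' =
        mset_tree h + D + image_mset (\<lambda>p. (dist q p, p)) (mset ps) \<and>
      (\<forall>x\<in>set_tree (snd (result (fill_heap q k ps n h))). \<forall>y\<in>#D'. fst x \<le> fst y))"
  using assms
proof (induction ps arbitrary: n h D)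
  case Nil
  then show ?case by auto
next
  case (Cons p ps)
  let ?x = "(dist q p, p)"
  consider (insert) "n < k" | (replace) "n = k" "dist q p < fst (value h)"
    | (skip) "n = k" "\<not> dist q p < fst (value h)" using Cons.prems(5) by linarith
  then show ?case
  proof cases
    case insert
    let ?h = "result (heap_insert ?x h)"
    have D: "D = {#}" using Cons.prems(7) insert by simp
    have "time (heap_insert ?x h) \<le> heap_height k + 1"
      using heap_insert_time[of ?x h] height_le_heap_height[of h k] Cons.prems(2,4,5) by linarith
    moreover have "fill_heap q k (p # ps) n h =
        bind_timed (step (dist q p)) (\<lambda>_. bind_timed (heap_insert ?x h) (fill_heap q k ps (n + 1)))"
      using insert by (simp add: bind_timed_def)
    ultimately show ?thesis
      using Cons.IH[of ?h "n + 1" "{#}"] Cons.prems(1-5) insert D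
      by (simp add: heap_insert_size heap_insert_braun heap_insert_heap heap_insert_mset)
  next
    case replace
    then obtain l a r where h: "h = Node l a r" using Cons.prems(1,4) by (cases h) auto
    let ?h = "result (sift_down l ?x r)"
    have s: "size l = size r \<or> size l = size r + 1" "braun l" "braun r" "fst_heap l" "fst_heap r"
      using Cons.prems(2,3) h by auto
    have t: "time (sift_down l ?x r) \<le> heap_height k"
      using sift_down_time[of l ?x r] height_le_heap_height[of h k] Cons.prems(2,4,5) h by simp
    have h': "braun ?h" "size ?h = n" "fst_heap ?h"
      using sift_down_braun[OF s(1-3), of ?x] sift_down_heap[OF s, of ?x] Cons.prems(4) h by auto
    \<comment> \<open>The evicted root \<open>a\<close> separates the two sides: it is a maximum of
      the old heap, farther than the new entry, and no farther than anything discarded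
      earlier.\<close>
    have "fst x \<le> fst y" if "x \<in> set_tree ?h" "y \<in># add_mset a D" for x y
    proof -
      have "fst x \<le> fst a"
        using that(1) Cons.prems(3) replace h sift_down_set[OF s(1-3), of ?x] by auto
      moreover have "fst a \<le> fst y" using that(2) Cons.prems(6) h by auto
      ultimately show ?thesis by linarith
    qed
    then have o: "\<forall>x\<in>set_tree ?h. \<forall>y\<in>#add_mset a D. fst x \<le> fst y" by blast
    have f: "fill_heap q k (p # ps) n h =
        bind_timed (step (dist q p)) (\<lambda>_. bind_timed (sift_down l ?x r) (fill_heap q k ps n))"
      using replace h by (simp add: bind_timed_def)
    show ?thesis
      using Cons.IH[OF \<open>1 \<le> k\<close> h'(1,3,2) \<open>n \<le> k\<close> o] replace(1) t
      unfolding f unfolding sift_down_mset[OF s(1-3), of ?x] h by (simp add: add_mset_commute)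
  next
    case skip
    have "\<forall>x\<in>set_tree h. \<forall>y\<in>#add_mset ?x D. fst x \<le> fst y"
      using fst_heap_value[OF Cons.prems(3)] skip Cons.prems(6) by fastforce
    from Cons.IH[OF Cons.prems(1-5) this] show ?thesis using skip by simp
  qed
qed

text \<open>Maxima are removed and put in front, so \<open>xs\<close> stays ascending and above the
  rest of the heap. A removal descends twice, once to detach an entry and once to sift it down,
  hence the factor 2.\<close>

lemma drain_heap_props:
  assumes "braun h" "fst_heap h" "size h = n" "n \<le> k"
    and "sorted (map fst xs)" "\<And>x y. x \<in> set_tree h \<Longrightarrow> y \<in> set xs \<Longrightarrow> fst x \<le> fst y"
  shows "mset (result (drain_heap n h xs)) = mset_tree h + mset xs \<and>
    sorted (map fst (result (drain_heap n h xs))) \<and>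
    time (drain_heap n h xs) \<le> n * (2 * heap_height k + 2) + 1"
  using assms
proof (induction n arbitrary: h xs)
  case (Suc n)
  let ?h = "result (delete_max h)"
  have "h \<noteq> Leaf" using Suc.prems by auto
  note d = delete_max_props[OF Suc.prems(1,2) this]
  have m: "mset_tree h = add_mset (value h) (mset_tree ?h)" using d by simp
  have st: "set_tree h = insert (value h) (set_tree ?h)"
    using arg_cong[OF m, of set_mset] by simp
  have sz: "size ?h = n" using arg_cong[OF m, of size] Suc.prems by (simp add: size_mset_tree)
  have t: "time (delete_max h) \<le> 2 * heap_height k + 1"
    using d height_le_heap_height[of h k] Suc.prems by linarith
  have "sorted (map fst (value h # xs))"
    using Suc.prems(5,6) st by auto
  moreover have "fst x \<le> fst y" if "x \<in> set_tree ?h" "y \<in> set (value h # xs)" for x y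
    using that Suc.prems(6)[of x y] fst_heap_value[OF Suc.prems(2), of x] st by auto
  ultimately have "mset (result (drain_heap n ?h (value h # xs))) = mset_tree ?h + mset (value h # xs) \<and>
    sorted (map fst (result (drain_heap n ?h (value h # xs)))) \<and>
    time (drain_heap n ?h (value h # xs)) \<le> n * (2 * heap_height k + 2) + 1"
    using Suc.IH[of ?h "value h # xs"] d sz Suc.prems(4) by simp
  then show ?case using t m by simp
qed auto

text \<open>Ties make the selection ambiguous. The multiset \<open>D\<close> of unselected entries
  expresses that the selected ones are nearest without fixing which of several equally distant
  points is taken.\<close>

lemma k_nearest_props:
  assumes "1 \<le> k"
  obtains D where
    "mset (result (k_nearest q k ps)) + D = image_mset (\<lambda>p. (dist q p, p)) (mset ps)"
    "length (result (k_nearest q k ps)) = min k (length ps)"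
    "sorted (map fst (result (k_nearest q k ps)))"
    "\<forall>x\<in>set (result (k_nearest q k ps)). \<forall>y\<in>#D. fst x \<le> fst y"
    "time (k_nearest q k ps) \<le> length ps * (3 * heap_height k + 4) + 2"
proof -
  obtain n h D where f: "result (fill_heap q k ps 0 Leaf) = (n, h)" "braun h" "fst_heap h"
    "size h = n" "n = min k (length ps)" "mset_tree h + D = image_mset (\<lambda>p. (dist q p, p)) (mset ps)"
    "\<forall>x\<in>set_tree h. \<forall>y\<in>#D. fst x \<le> fst y"
    "time (fill_heap q k ps 0 Leaf) \<le> length ps * (heap_height k + 2) + 1"
    using fill_heap_props[OF assms, of Leaf 0 "{#}" q ps] by (force simp: prod_eq_iff)
  have d: "mset (result (drain_heap n h [])) = mset_tree h \<and>
    sorted (map fst (result (drain_heap n h []))) \<and>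
    time (drain_heap n h []) \<le> n * (2 * heap_height k + 2) + 1"
    using drain_heap_props[OF f(2-4), of k "[]"] f(5) by simp
  have st: "set (result (drain_heap n h [])) = set_tree h"
    using d by (metis set_mset_mset set_mset_tree)
  have "length (result (drain_heap n h [])) = n"
    using d f(4) by (metis size_mset size_mset_tree)
  moreover have "n * (2 * heap_height k + 2) \<le> length ps * (2 * heap_height k + 2)"
    unfolding f(5) by (intro mult_right_mono) auto
  ultimately show thesis
    using d f st by (intro that[of D]) (auto simp: k_nearest_def algebra_simps)
qed

lemma scan_sizes_props:
  "time (scan_sizes sz k s xs) \<le> length xs + 1"
  "s < k \<Longrightarrow> k \<le> s + (\<Sum>x\<leftarrow>xs. sz (snd x)) \<Longrightarrow>
    \<exists>ys zs. xs = ys @ result (scan_sizes sz k s xs) # zs \<and>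
      s + (\<Sum>x\<leftarrow>ys. sz (snd x)) < k \<and>
      k \<le> s + (\<Sum>x\<leftarrow>ys. sz (snd x)) + sz (snd (result (scan_sizes sz k s xs)))"
proof (induction sz k s xs rule: scan_sizes.induct)
  case (2 sz k s x xs)
  { case 1 then show ?case using 2(1) by auto }
  { case 2
    show ?case
    proof (cases "k \<le> s + sz (snd x)")
      case True
      then show ?thesis using 2 by (intro exI[of _ "[]"] exI[of _ xs]) auto
    next
      case False
      then obtain ys zs where "xs = ys @ result (scan_sizes sz k (s + sz (snd x)) xs) # zs"
        "s + sz (snd x) + (\<Sum>x\<leftarrow>ys. sz (snd x)) < k"
        "k \<le> s + sz (snd x) + (\<Sum>x\<leftarrow>ys. sz (snd x)) + sz (snd (result (scan_sizes sz k (s + sz (snd x)) xs)))"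
        using 2 "2.IH"(2) by auto
      then show ?thesis using False by (intro exI[of _ "x # ys"] exI[of _ zs]) auto
    qed }
qed auto

text \<open>Looking at only \<open>k\<close> candidates is enough because each has size at least 1.
  The \<lambda>-point is used solely through its distance \<open>d\<close> and the two sums: the
  strictly nearer candidates stay below \<open>k\<close>, those within \<open>d\<close> reach
  it.\<close>

lemma lambda_point_props:
  fixes T :: "'a::metric_space cover_tree" and i :: int and sz :: "'a \<Rightarrow> nat"
  defines "sz \<equiv> \<lambda>p. card (S_set T i p)"
  assumes "1 \<le> k" "distinct C" "\<And>p. p \<in> set C \<Longrightarrow> 1 \<le> sz p" "k \<le> (\<Sum>p\<in>set C. sz p)"
  obtains d p where "result (lambda_point T q k i C) = (d, p)"
    "(\<Sum>p\<in>{p\<in>set C. dist q p < d}. sz p) < k" "k \<le> (\<Sum>p\<in>{p\<in>set C. dist q p \<le> d}. sz p)"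
    "time (lambda_point T q k i C) \<le> length C * (3 * heap_height k + 5) + 3"
proof -
  let ?xs = "result (k_nearest q k C)"
  let ?f = "\<lambda>p. (dist q p, p)"
  obtain D where D: "mset ?xs + D = image_mset ?f (mset C)" "length ?xs = min k (length C)"
    "sorted (map fst ?xs)" "\<forall>x\<in>set ?xs. \<forall>y\<in>#D. fst x \<le> fst y"
    "time (k_nearest q k C) \<le> length C * (3 * heap_height k + 4) + 2"
    by (rule k_nearest_props[OF assms(2), of q C])
  have inC: "fst x = dist q (snd x) \<and> snd x \<in> set C" if "x \<in> set ?xs" for x
  proof -
    have "x \<in># image_mset ?f (mset C)" using that unfolding D(1)[symmetric] by simp
    then show ?thesis by auto
  qed
  have "distinct (map ?f C)" using assms(3) by (simp add: distinct_map inj_on_def)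
  \<comment> \<open>The selected list is known only through a multiset equation, so its distinctness
    is derived from multiplicities.\<close>
  then have le1: "count (mset ?xs + D) x \<le> 1" for x
    unfolding D(1) mset_map[symmetric]
    by (simp add: distinct_count_atmost_1 del: mset_map set_map split_paired_All)
  have dxs: "distinct ?xs"
  proof -
    have "count (mset ?xs) x = (if x \<in> set ?xs then 1 else 0)" for x
    proof (cases "x \<in> set ?xs")
      case True
      then have "0 < count (mset ?xs) x" by (simp only: count_greater_zero_iff set_mset_mset)
      then have "count (mset ?xs) x = 1" using le1[of x] unfolding count_union by linarith
      then show ?thesis using True by simp
    qed (simp add: count_eq_zero_iff)
    then show ?thesis by (simp add: distinct_count_atmost_1)
  qed
  have "inj_on snd (set ?xs)"
    by (rule inj_onI, rule prod_eqI) (use inC in auto)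
  then have dsnd: "distinct (map snd ?xs)" using dxs by (simp add: distinct_map)
  \<comment> \<open>Either \<open>k\<close> points are selected, each contributing at least 1, or
    nothing is left out and the sum is the full one.\<close>
  have ge: "k \<le> (\<Sum>x\<leftarrow>?xs. sz (snd x))"
  proof (cases "k \<le> length C")
    case True
    have "length ?xs = (\<Sum>x\<leftarrow>?xs. 1)" by (simp add: sum_list_triv)
    also have "\<dots> \<le> (\<Sum>x\<leftarrow>?xs. sz (snd x))"
      by (rule sum_list_mono) (use inC assms(4) in blast)
    finally show ?thesis using D(2) True by simp
  next
    case False
    then have "size D = 0" using arg_cong[OF D(1), of size] D(2) by simp
    then have "mset ?xs = mset (map ?f C)" using D(1) by simp
    then have "sum_mset (image_mset (\<lambda>x. sz (snd x)) (mset ?xs)) =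
        sum_mset (image_mset (\<lambda>x. sz (snd x)) (mset (map ?f C)))" by (simp only:)
    then have "(\<Sum>x\<leftarrow>?xs. sz (snd x)) = (\<Sum>p\<leftarrow>C. sz p)"
      by (simp only: mset_map[symmetric] sum_mset_sum_list map_map comp_def snd_conv)
    then show ?thesis using assms(3,5) by (simp add: sum_list_distinct_conv_sum_set)
  qed
  define x where "x = result (scan_sizes sz k 0 ?xs)"
  have "\<exists>ys zs. ?xs = ys @ x # zs \<and> (\<Sum>x\<leftarrow>ys. sz (snd x)) < k \<and> k \<le> (\<Sum>x\<leftarrow>ys. sz (snd x)) + sz (snd x)"
    using scan_sizes_props(2)[of 0 k sz ?xs] ge assms(2) by (simp add: x_def)
  then obtain ys zs where x: "x = result (scan_sizes sz k 0 ?xs)" "?xs = ys @ x # zs"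
    "(\<Sum>x\<leftarrow>ys. sz (snd x)) < k" "k \<le> (\<Sum>x\<leftarrow>ys. sz (snd x)) + sz (snd x)"
    using x_def by blast
  have xd: "fst x = dist q (snd x)" using inC[of x] x(2) by simp
  have sumys: "(\<Sum>x\<leftarrow>ys. sz (snd x)) = (\<Sum>p\<in>snd ` set ys. sz p)"
    using dsnd x(2) by (simp add: distinct_map sum.reindex sum_list_distinct_conv_sum_set)
  \<comment> \<open>A candidate nearer than \<open>x\<close> is not among the unselected ones, and
    by sortedness it precedes \<open>x\<close>.\<close>
  have "{p\<in>set C. dist q p < fst x} \<subseteq> snd ` set ys"
  proof clarify
    fix p assume p: "p \<in> set C" "dist q p < fst x"
    have "?f p \<in># mset ?xs + D" using p unfolding D(1) by auto
    moreover have "\<not> ?f p \<in># D" using D(4) x(2) p(2) by auto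
    ultimately have "?f p \<in> set ?xs" by simp
    moreover have "fst x \<le> fst z" if "z \<in> set (x # zs)" for z
      using D(3) x(2) that by (auto simp: sorted_append)
    ultimately have "?f p \<in> set ys" using p(2) x(2)
      by (metis Un_iff fst_conv linorder_not_le set_append)
    then show "p \<in> snd ` set ys" by force
  qed
  then have near: "(\<Sum>p\<in>{p\<in>set C. dist q p < fst x}. sz p) < k"
    using x(3) sumys sum_mono2[of "snd ` set ys" "{p\<in>set C. dist q p < fst x}" sz] by simp
  have "insert (snd x) (snd ` set ys) \<subseteq> {p\<in>set C. dist q p \<le> fst x}"
  proof -
    have "dist q (snd z) \<le> fst x" if "z \<in> set ys" for z
    proof -
      have "fst z \<le> fst x" using D(3) x(2) that by (auto simp: sorted_append)
      moreover have "z \<in> set ?xs" using x(2) that by simp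
      ultimately show ?thesis using inC[of z] by simp
    qed
    moreover have "snd z \<in> set C" if "z \<in> set ys \<or> z = x" for z
      using inC[of z] x(2) that by auto
    ultimately show ?thesis using xd by auto
  qed
  moreover have "snd x \<notin> snd ` set ys" using dsnd x(2) by auto
  ultimately have "k \<le> (\<Sum>p\<in>{p\<in>set C. dist q p \<le> fst x}. sz p)"
    using sumys x(4) sum_mono2[of "{p\<in>set C. dist q p \<le> fst x}" "insert (snd x) (snd ` set ys)" sz] by simp
  moreover have "time (lambda_point T q k i C) \<le> length C * (3 * heap_height k + 5) + 3"
    using D(2,5) scan_sizes_props(1)[of sz k 0 ?xs] by (simp add: lambda_point_def sz_def algebra_simps)
  ultimately show thesis
    using x(1) near by (intro that[of "fst x" "snd x"]) (simp_all add: lambda_point_def sz_def)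
qed

section \<open>Elementary passes over lists\<close>

lemma append_timed_props:
  "result (append_timed xs ys) = xs @ ys" "time (append_timed xs ys) = length xs + 1"
  by (induction xs) auto

lemma candidates_props:
  "mset (result (candidates G i ps)) = mset ps + mset (concat (map (\<lambda>p. G p i) ps))"
  "time (candidates G i ps) \<le> 2 * length (result (candidates G i ps)) + 1"
  by (induction ps) (auto simp: append_timed_props)

lemma filter_dist_props:
  "result (filter_dist Q q ps) = filter (\<lambda>p. Q (dist q p)) ps" "time (filter_dist Q q ps) = length ps + 1"
  by (induction ps) auto

lemma max_Next_time: "time (max_Next T i as m) = length as + 1"
  by (induction as arbitrary: m) auto

lemma max_Next_ge:
  "m \<le> result (max_Next T i as m) \<and> (\<forall>a\<in>set as. Next T a i \<le> result (max_Next T i as m))"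
proof (induction as arbitrary: m)
  case (Cons a as)
  then have "max (Next T a i) m \<le> result (max_Next T i as (max (Next T a i) m))" by blast
  then show ?case using Cons[of "max (Next T a i) m"] by simp
qed simp

lemma points_of_props:
  "result (points_of xs) = map snd xs" "time (points_of xs) = length xs + 1"
  by (induction xs) auto

section \<open>Distinctive descendant sets\<close>

locale compressed_tree =
  fixes R :: "'a::metric_space set" and T :: "'a cover_tree"
  assumes tree: "compressed_cover_tree R T"
begin

lemma points_eq [simp]: "points T = R" and fin [simp]: "finite R" and root_in: "root T \<in> R"
  using tree by (auto simp: compressed_cover_tree_def)

lemma level_root: "p \<in> R \<Longrightarrow> p \<noteq> root T \<Longrightarrow> 1 + level T p \<le> level T (root T)"
  using tree by (auto simp: compressed_cover_tree_def)

lemma is_child_iff: "is_child T c p \<longleftrightarrow> c \<in> R \<and> c \<noteq> root T \<and> parent T c = p"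
  using tree by (auto simp: compressed_cover_tree_def is_child_def)

lemma is_child_level: "is_child T c p \<Longrightarrow> level T c < level T p"
  using tree by (auto simp: compressed_cover_tree_def is_child_def)

lemma is_child_dist: "is_child T c p \<Longrightarrow> dist c p \<le> 2 powi (level T c + 1)"
  using tree by (auto simp: compressed_cover_tree_def is_child_def)

lemma is_child_in: "is_child T c p \<Longrightarrow> c \<in> R \<and> p \<in> R"
  by (auto simp: is_child_def)

lemma is_child_unique: "is_child T c p \<Longrightarrow> is_child T c p' \<Longrightarrow> p = p'"
  by (auto simp: is_child_def)

lemma sparse: "p \<in> cover_set T i \<Longrightarrow> q \<in> cover_set T i \<Longrightarrow> p \<noteq> q \<Longrightarrow> 2 powi i < dist p q"
  using tree by (auto simp: compressed_cover_tree_def)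

lemma cover_set_iff: "p \<in> cover_set T i \<longleftrightarrow> p \<in> R \<and> i \<le> level T p"
  by (auto simp: cover_set_def)

lemma l_min_le: "p \<in> R \<Longrightarrow> l_min T \<le> level T p"
  by (auto simp: l_min_def)

lemma Desc_refl: "p \<in> R \<Longrightarrow> p \<in> Desc T p"
  by (auto simp: Desc_def)

lemma Desc_subset: "Desc T p \<subseteq> R"
  by (auto simp: Desc_def)

lemma Desc_trans: "u \<in> Desc T v \<Longrightarrow> v \<in> Desc T w \<Longrightarrow> u \<in> Desc T w"
  by (auto simp: Desc_def)

lemma child_in_Desc: "is_child T c p \<Longrightarrow> c \<in> Desc T p"
  by (auto simp: Desc_def dest: is_child_in)

lemma Desc_level: "u \<in> Desc T p \<Longrightarrow> level T u < level T p \<or> u = p"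
proof -
  have "(is_child T)\<^sup>*\<^sup>* u p \<Longrightarrow> level T u < level T p \<or> u = p"
    by (induction rule: rtranclp_induct) (auto dest: is_child_level)
  then show "u \<in> Desc T p \<Longrightarrow> ?thesis" by (auto simp: Desc_def)
qed

lemma Desc_levelD: "u \<in> Desc T p \<Longrightarrow> level T u \<le> level T p"
  using Desc_level by force

lemma Desc_antisym: "u \<in> Desc T p \<Longrightarrow> p \<in> Desc T u \<Longrightarrow> u = p"
  using Desc_level[of u p] Desc_level[of p u] by auto

text \<open>Parents are unique, so the ancestors of a point form a chain.\<close>

lemma Desc_linear:
  assumes "u \<in> Desc T v" "u \<in> Desc T w"
  shows "v \<in> Desc T w \<or> w \<in> Desc T v"
proof -
  have "(is_child T)\<^sup>*\<^sup>* u v \<Longrightarrow> (is_child T)\<^sup>*\<^sup>* u w \<Longrightarrow> (is_child T)\<^sup>*\<^sup>* v w \<or> (is_child T)\<^sup>*\<^sup>* w v"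
  proof (induction rule: rtranclp_induct)
    case (step y z)
    from step.IH[OF step.prems] show ?case
    proof
      assume "(is_child T)\<^sup>*\<^sup>* y w"
      then show ?thesis
      proof (cases rule: converse_rtranclpE)
        case base
        then show ?thesis using step.hyps(2) by blast
      next
        case (step y')
        then show ?thesis using is_child_unique[OF \<open>is_child T y z\<close> step(1)] by simp
      qed
    next
      assume "(is_child T)\<^sup>*\<^sup>* w y"
      then show ?thesis using rtranclp.rtrancl_into_rtrancl[of "is_child T" w y z] step.hyps(2) by simp
    qed
  qed simp
  moreover have "v \<in> R \<and> w \<in> R"
  proof -
    have "v \<in> R" if "(is_child T)\<^sup>*\<^sup>* u v" "u \<in> R" for v
      using that by (induction rule: rtranclp_induct) (simp_all add: is_child_in)
    then show ?thesis using assms by (simp add: Desc_def)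
  qed
  ultimately show ?thesis using assms unfolding Desc_def by simp
qed

lemma Desc_childE:
  assumes "u \<in> Desc T p" "u \<noteq> p"
  obtains c where "is_child T c p" "u \<in> Desc T c"
proof -
  have "(is_child T)\<^sup>*\<^sup>* u p" using assms(1) by (simp add: Desc_def)
  then show thesis
  proof (cases rule: rtranclp.cases)
    case (rtrancl_into_rtrancl c)
    then show ?thesis using that[of c] assms(1) by (simp add: Desc_def)
  qed (use assms(2) in simp)
qed

lemma Desc_parent:
  assumes "is_child T c p" "c \<in> Desc T w" "w \<noteq> c"
  shows "p \<in> Desc T w"
proof -
  have "(is_child T)\<^sup>*\<^sup>* c w" using assms(2) by (simp add: Desc_def)
  then have "(is_child T)\<^sup>*\<^sup>* p w"
    using is_child_unique[OF assms(1)] assms(3) by (cases rule: converse_rtranclpE) auto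
  then show ?thesis using is_child_in[OF assms(1)] by (simp add: Desc_def)
qed

text \<open>Levels increase strictly towards the root. The bound for the path so far equals the
  bound for the next edge, and their sum is absorbed by the next level.\<close>

lemma Desc_dist: "u \<in> Desc T p \<Longrightarrow> dist u p \<le> 2 powi (level T p + 1)"
proof -
  have "(is_child T)\<^sup>*\<^sup>* u p \<Longrightarrow> dist u p \<le> 2 powi (level T p + 1)"
  proof (induction rule: rtranclp_induct)
    case (step y z)
    have "dist u z \<le> dist u y + dist y z" by (rule dist_triangle)
    also have "\<dots> \<le> 2 powi (level T y + 1) + 2 powi (level T y + 1)"
      using step is_child_dist by (intro add_mono) auto
    also have "\<dots> = 2 powi (level T y + 1 + 1)"
      by (simp add: power_int_add)
    also have "\<dots> \<le> 2 powi (level T z + 1)"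
      using is_child_level[OF step(2)] by (intro power_int_increasing) auto
    finally show ?case .
  qed simp
  then show "u \<in> Desc T p \<Longrightarrow> ?thesis" by (auto simp: Desc_def)
qed

text \<open>Proper descendants have smaller levels, so the upper bound on levels in
  \<open>V_set\<close> excludes exactly \<open>p\<close> itself.\<close>

lemma S_set_iff:
  "u \<in> S_set T i p \<longleftrightarrow> u \<in> Desc T p \<and>
     (\<forall>w \<in> Desc T p. u \<in> Desc T w \<longrightarrow> i \<le> level T w \<longrightarrow> w = p)"
  unfolding S_set_def V_set_def using Desc_level by fastforce

lemma S_set_subset: "S_set T i p \<subseteq> R"
  using Desc_subset by (auto simp: S_set_def)

lemma finite_S_set: "finite (S_set T i p)"
  using S_set_subset finite_subset fin by blast

lemma S_set_self: "p \<in> R \<Longrightarrow> p \<in> S_set T i p"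
  using Desc_refl Desc_antisym by (simp add: S_set_iff)

lemma S_set_disjoint:
  assumes "p \<in> cover_set T i" "p' \<in> cover_set T i" "u \<in> S_set T i p" "u \<in> S_set T i p'"
  shows "p = p'"
  using assms Desc_linear[of u p p'] by (auto simp: S_set_iff cover_set_iff)

text \<open>The radius depends on \<open>i\<close> and not on the level of \<open>p\<close>: the
  child of \<open>p\<close> on the path to \<open>u\<close> has level below \<open>i\<close>, as
  otherwise \<open>u\<close> would belong to that child or to something lower.\<close>

lemma S_set_dist:
  assumes "u \<in> S_set T i p"
  shows "dist u p \<le> 2 powi (i + 1)"
proof (cases "u = p")
  case False
  then obtain c where c: "is_child T c p" "u \<in> Desc T c"
    using Desc_childE assms by (auto simp: S_set_iff)
  then have "level T c < i"
    using assms child_in_Desc[OF c(1)] is_child_level[OF c(1)] by (auto simp: S_set_iff)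
  have "dist u p \<le> dist u c + dist c p" by (rule dist_triangle)
  also have "\<dots> \<le> 2 powi (level T c + 1) + 2 powi (level T c + 1)"
    using c Desc_dist is_child_dist by (intro add_mono) auto
  also have "\<dots> = 2 powi (level T c + 1 + 1)" by (simp add: power_int_add)
  also have "\<dots> \<le> 2 powi (i + 1)"
    using \<open>level T c < i\<close> by (intro power_int_increasing) auto
  finally show ?thesis .
qed simp

lemma S_set_bottom:
  assumes "p \<in> R" "i \<le> l_min T"
  shows "S_set T i p = {p}"
proof -
  have "u = p" if "u \<in> S_set T i p" for u
  proof -
    have "u \<in> R" using that S_set_subset by blast
    then have "i \<le> level T u" "u \<in> Desc T u" using l_min_le assms Desc_refl by fastforce+
    then show ?thesis using that by (auto simp: S_set_iff)
  qed
  then show ?thesis using S_set_self[OF assms(1)] by auto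
qed

lemma S_set_no_child:
  assumes "p \<in> R" "\<And>c. is_child T c p \<Longrightarrow> \<not> level T c < i"
  shows "S_set T i p = {p}"
proof -
  have "u = p" if u: "u \<in> S_set T i p" for u
  proof (rule ccontr)
    assume "u \<noteq> p"
    then obtain c where c: "is_child T c p" "u \<in> Desc T c"
      using Desc_childE u by (auto simp: S_set_iff)
    then show False
      using assms(2)[OF c(1)] u child_in_Desc[OF c(1)] is_child_level[OF c(1)] by (auto simp: S_set_iff)
  qed
  then show ?thesis using S_set_self[OF assms(1)] by auto
qed

text \<open>Every point descends from the root, by induction on its level gap to the root, which
  shrinks on passing to the parent.\<close>

lemma S_set_root:
  assumes "\<And>p. p \<in> R \<Longrightarrow> p \<noteq> root T \<Longrightarrow> level T p < i"
  shows "S_set T i (root T) = R"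
proof -
  have "u \<in> R \<Longrightarrow> u \<in> Desc T (root T)" for u
  proof (induction "nat (level T (root T) - level T u)" arbitrary: u rule: less_induct)
    case less
    show ?case
    proof (cases "u = root T")
      case False
      have c: "is_child T u (parent T u)" using less.prems False by (simp add: is_child_iff)
      have "level T (parent T u) \<le> level T (root T)"
        using level_root is_child_in[OF c] by force
      then have "parent T u \<in> Desc T (root T)"
        using is_child_level[OF c] is_child_in[OF c] by (intro less.hyps) auto
      then show ?thesis using child_in_Desc[OF c] Desc_trans by blast
    qed (simp add: Desc_refl root_in)
  qed
  then show ?thesis using assms Desc_subset by (force simp: S_set_iff)
qed

text \<open>The child of \<open>p\<close> on the path to \<open>u\<close> has level at most
  \<open>j\<close>. At level exactly \<open>j\<close> it becomes the lowest admissible ancestor of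
  \<open>u\<close>; below \<open>j\<close>, that ancestor is still \<open>p\<close>. This one
  identity covers the passage to the next level, the jump over empty levels and the traversal of
  descendants.\<close>

lemma S_set_refine:
  assumes "p \<in> cover_set T i" "j < i"
    and gap: "\<And>c. is_child T c p \<Longrightarrow> level T c < i \<Longrightarrow> level T c \<le> j"
  shows "S_set T i p = S_set T j p \<union> (\<Union>c\<in>{c. is_child T c p \<and> level T c = j}. S_set T j c)"
    (is "_ = _ \<union> ?C")
proof
  show "S_set T i p \<subseteq> S_set T j p \<union> ?C"
  proof
    fix u assume u: "u \<in> S_set T i p"
    show "u \<in> S_set T j p \<union> ?C"
    proof (cases "u = p")
      case True
      then show ?thesis using assms S_set_self by (auto simp: cover_set_iff)
    next
      case False
      then obtain c where c: "is_child T c p" "u \<in> Desc T c"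
        using Desc_childE u by (auto simp: S_set_iff)
      have "level T c < i"
        using u c child_in_Desc[OF c(1)] is_child_level[OF c(1)] by (force simp: S_set_iff)
      then have "level T c \<le> j" using gap c by blast
      show ?thesis
      proof (cases "level T c = j")
        case True
        then have "u \<in> S_set T j c" using c Desc_level by (force simp: S_set_iff)
        then show ?thesis using c True by blast
      next
        case False
        have "w = p" if w: "w \<in> Desc T p" "u \<in> Desc T w" "j \<le> level T w" for w
        proof -
          have "\<not> w \<in> Desc T c" using Desc_levelD[of w c] w False \<open>level T c \<le> j\<close> by linarith
          then have "c \<in> Desc T w" "w \<noteq> c" using Desc_linear[OF w(2) c(2)] Desc_refl is_child_in c by blast+
          then have "p \<in> Desc T w" using Desc_parent c by blast
          then show ?thesis using Desc_antisym[OF w(1)] by simp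
        qed
        then show ?thesis using u by (auto simp: S_set_iff)
      qed
    qed
  qed
  have "S_set T j p \<subseteq> S_set T i p" using \<open>j < i\<close> by (auto simp: S_set_iff)
  moreover have "S_set T j c \<subseteq> S_set T i p" if c: "is_child T c p" "level T c = j" for c
  proof
    fix u assume u: "u \<in> S_set T j c"
    have "w = p" if w: "w \<in> Desc T p" "u \<in> Desc T w" "i \<le> level T w" for w
    proof -
      have "\<not> w \<in> Desc T c" using Desc_levelD[of w c] w c \<open>j < i\<close> by linarith
      then have "c \<in> Desc T w" "w \<noteq> c"
        using Desc_linear[OF w(2), of c] Desc_refl is_child_in c u by (auto simp: S_set_iff)
      then have "p \<in> Desc T w" using Desc_parent c by blast
      then show ?thesis using Desc_antisym[OF w(1)] by simp
    qed
    then show "u \<in> S_set T i p"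
      using u child_in_Desc[OF c(1)] Desc_trans by (fastforce simp: S_set_iff)
  qed
  ultimately show "S_set T j p \<union> ?C \<subseteq> S_set T i p" by blast
qed

lemma Next_cases:
  obtains (none) "Next T p i = l_min T - 1" "\<And>c. is_child T c p \<Longrightarrow> \<not> level T c < i"
  | (some) c where "is_child T c p" "level T c = Next T p i" "Next T p i < i" "l_min T \<le> Next T p i"
      "\<And>c. is_child T c p \<Longrightarrow> level T c < i \<Longrightarrow> level T c \<le> Next T p i"
proof -
  define L where "L = {level T c | c. is_child T c p \<and> level T c < i}"
  show thesis
  proof (cases "L = {}")
    case True
    then show thesis using none by (auto simp: Next_def L_def)
  next
    case False
    have N: "Next T p i = Sup L" using False unfolding Next_def Let_def L_def[symmetric] by simp
    have "L \<subseteq> level T ` R" using is_child_in by (auto simp: L_def)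
    then have "finite L" using finite_subset fin by blast
    then have S: "Sup L = Max L" using False by (simp add: cSup_eq_Max)
    then have "Sup L \<in> L" using Max_in \<open>finite L\<close> False by simp
    then obtain c where c: "is_child T c p" "level T c = Next T p i" "Next T p i < i" by (auto simp: L_def N)
    have "level T c' \<le> Next T p i" if "is_child T c' p" "level T c' < i" for c'
      unfolding N S by (rule Max_ge[OF \<open>finite L\<close>]) (use that in \<open>auto simp: L_def\<close>)
    then show thesis using some[OF c] c l_min_le is_child_in by metis
  qed
qed

lemma child_le_Next: "is_child T c p \<Longrightarrow> level T c < i \<Longrightarrow> level T c \<le> Next T p i"
  by (cases p i rule: Next_cases) auto

end

section \<open>Listing of descendants\<close>

fun task_points :: "'a cover_tree \<Rightarrow> 'a task \<Rightarrow> 'a set" where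
  "task_points T (Siblings ps j) = (\<Union>p\<in>set ps. S_set T j p)"
| "task_points T (Below p j) = S_set T j p - {p}"

fun task_ok :: "'a cover_tree \<Rightarrow> 'a task \<Rightarrow> bool" where
  "task_ok T (Siblings ps j) \<longleftrightarrow> distinct ps \<and> set ps \<subseteq> cover_set T j"
| "task_ok T (Below p j) \<longleftrightarrow> p \<in> cover_set T j"

text \<open>Tasks are processed in order, so the output is a prefix of the concatenated enumerations
  of their point sets. The lists \<open>Ls\<close> are existential because enumerations beyond the
  cut are never produced; at \<open>b = 0\<close> any will do.\<close>

lemma list_descendants_result:
  assumes "compressed_tree R T" "child_groups T G" "\<forall>t\<in>set ts. task_ok T t"
  shows "\<exists>Ls. list_all2 (\<lambda>t L. distinct L \<and> set L = task_points T t) ts Ls \<and>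
    result (list_descendants T G b ts) = take b (concat Ls)"
  using assms
proof (induction T G b ts rule: list_descendants.induct)
  case (1 T G ts)
  interpret compressed_tree R T by fact
  have "finite (task_points T t)" for t
    by (cases t) (simp_all add: finite_S_set)
  then have "\<exists>L. distinct L \<and> set L = task_points T t" for t
    using finite_distinct_list by metis
  then obtain f where "\<And>t. distinct (f t) \<and> set (f t) = task_points T t" by metis
  then have "list_all2 (\<lambda>t L. distinct L \<and> set L = task_points T t) ts (map f ts)"
    by (simp add: list.rel_map list.rel_refl)
  then show ?case by auto
next
  case (2 T G b)
  then show ?case by auto
next
  case (3 T G b j ts)
  then obtain Ls where "list_all2 (\<lambda>t L. distinct L \<and> set L = task_points T t) ts Ls"
    "result (list_descendants T G (Suc b) ts) = take (Suc b) (concat Ls)" by auto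
  then show ?case by (intro exI[of _ "[] # Ls"]) auto
next
  case (4 T G b p ps j ts)
  interpret compressed_tree R T by fact
  have ok: "distinct (p # ps)" "set (p # ps) \<subseteq> cover_set T j" using 4 by auto
  obtain Ls where Ls: "list_all2 (\<lambda>t L. distinct L \<and> set L = task_points T t) (Below p j # Siblings ps j # ts) Ls"
    "result (list_descendants T G b (Below p j # Siblings ps j # ts)) = take b (concat Ls)"
    using "4.IH"[OF refl "4.prems"(1,2)] "4.prems"(3) by auto
  then obtain L1 L2 Ls' where L: "Ls = L1 # L2 # Ls'" "distinct L1" "set L1 = S_set T j p - {p}"
    "distinct L2" "set L2 = (\<Union>p\<in>set ps. S_set T j p)"
    "list_all2 (\<lambda>t L. distinct L \<and> set L = task_points T t) ts Ls'"
    by (auto simp: list_all2_Cons1)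
  have "S_set T j p \<inter> S_set T j p' = {}" if "p' \<in> set ps" for p'
    using S_set_disjoint[of p j p'] ok that by auto
  then have "S_set T j p \<inter> set L2 = {}" unfolding L(5) by blast
  moreover have "p \<in> S_set T j p" using S_set_self ok by (simp add: cover_set_iff)
  ultimately have "distinct (p # L1 @ L2) \<and> set (p # L1 @ L2) = task_points T (Siblings (p # ps) j)"
    using L by auto
  then have "list_all2 (\<lambda>t L. distinct L \<and> set L = task_points T t) (Siblings (p # ps) j # ts) ((p # L1 @ L2) # Ls')"
    using L by simp
  moreover have "result (list_descendants T G (Suc b) (Siblings (p # ps) j # ts)) =
      take (Suc b) (concat ((p # L1 @ L2) # Ls'))"
    using Ls(2) L(1) by simp
  ultimately show ?case by blast
next
  case (5 T G b p j ts)
  interpret compressed_tree R T by fact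
  have p: "p \<in> cover_set T j" "p \<in> R" using 5 by (auto simp: cover_set_iff)
  show ?case
  proof (cases p j rule: Next_cases)
    case none
    then have "task_points T (Below p j) = {}" using S_set_no_child p by simp
    moreover obtain Ls where "list_all2 (\<lambda>t L. distinct L \<and> set L = task_points T t) ts Ls"
      "result (list_descendants T G (Suc b) ts) = take (Suc b) (concat Ls)"
      using "5.IH"(1)[OF refl _ "5.prems"(1,2)] "5.prems"(3) none by auto
    ultimately show ?thesis using none by (intro exI[of _ "[] # Ls"]) auto
  next
    case (some c)
    let ?j = "Next T p j"
    let ?cs = "G p ?j"
    have cs: "distinct ?cs" "set ?cs = {c. is_child T c p \<and> level T c = ?j}"
      using "5.prems"(2) p by (simp_all add: child_groups_def)
    have ok: "task_ok T (Siblings ?cs ?j)" "task_ok T (Below p ?j)"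
      using cs p some(3) by (auto simp: cover_set_iff dest: is_child_in)
    obtain Ls where Ls: "list_all2 (\<lambda>t L. distinct L \<and> set L = task_points T t) (Siblings ?cs ?j # Below p ?j # ts) Ls"
      "result (list_descendants T G (Suc b) (Siblings ?cs ?j # Below p ?j # ts)) = take (Suc b) (concat Ls)"
      using "5.IH"(2)[OF refl _ refl "5.prems"(1,2)] "5.prems"(3) ok some(4) by auto
    then obtain L1 L2 Ls' where L: "Ls = L1 # L2 # Ls'" "distinct L1" "set L1 = (\<Union>p\<in>set ?cs. S_set T ?j p)"
      "distinct L2" "set L2 = S_set T ?j p - {p}"
      "list_all2 (\<lambda>t L. distinct L \<and> set L = task_points T t) ts Ls'"
      by (auto simp: list_all2_Cons1)
    have "S_set T ?j p \<inter> S_set T ?j c = {}" if "c \<in> set ?cs" for c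
    proof -
      have "c \<in> cover_set T ?j" "p \<in> cover_set T ?j" "c \<noteq> p"
        using ok that cs is_child_level by auto
      then show ?thesis using S_set_disjoint[of p ?j c] by auto
    qed
    then have disj: "S_set T ?j p \<inter> set L1 = {}" unfolding L(3) by blast
    have pS: "p \<in> S_set T ?j p" using S_set_self p by simp
    have "S_set T j p = S_set T ?j p \<union> set L1"
      unfolding L(3) cs(2) by (rule S_set_refine[OF p(1) some(3,5)])
    then have "set (L1 @ L2) = task_points T (Below p j)"
      using disj pS L(5) by auto
    moreover have "distinct (L1 @ L2)" using L disj by auto
    ultimately have "list_all2 (\<lambda>t L. distinct L \<and> set L = task_points T t) (Below p j # ts) ((L1 @ L2) # Ls')"
      using L(6) by simp
    moreover have "result (list_descendants T G (Suc b) (Below p j # ts)) = take (Suc b) (concat ((L1 @ L2) # Ls'))"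
      using Ls(2) L(1) some(4) by simp
    ultimately show ?thesis by blast
  qed
qed

text \<open>A nonempty \<^const>\<open>Siblings\<close> task at the head has three steps of credit, since it lists a point
  immediately. This pays for the lookups of a \<^const>\<open>Below\<close> task, whose child groups are nonempty.\<close>

lemma list_descendants_time:
  assumes "compressed_tree R T" "child_groups T G"
  shows "time (list_descendants T G b ts) +
      (case ts of Siblings (p # ps) j # _ \<Rightarrow> if b = 0 then 0 else 3 | _ \<Rightarrow> 0) \<le> 5 * b + length ts + 1"
  using assms
proof (induction T G b ts rule: list_descendants.induct)
  case (1 T G ts)
  then show ?case by (auto split: list.split task.split)
next
  case (3 T G b j ts)
  then show ?case by simp
next
  \<comment> \<open>Listing a point costs one step, releases the credit of three and replaces one
    task by two: this is the factor 5.\<close>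
  case (4 T G b p ps j ts)
  then show ?case by simp
next
  case (5 T G b p j ts)
  interpret compressed_tree R T by fact
  show ?case
  proof (cases p j rule: Next_cases)
    case none
    then show ?thesis using "5.IH"(1)[OF refl _ "5.prems"] by simp
  next
    case (some c)
    \<comment> \<open>Since \<open>Next\<close> is attained, the group is nonempty. The two lookups
      and the additional task use up exactly the credit of three.\<close>
    then have "c \<in> set (G p (Next T p j))"
      using "5.prems"(2) is_child_in by (auto simp: child_groups_def)
    then obtain c' cs where "G p (Next T p j) = c' # cs" by (cases "G p (Next T p j)") auto
    then show ?thesis using "5.IH"(2)[OF refl _ refl "5.prems"] some(4) by simp
  qed
qed simp

section \<open>The main loop\<close>

declare knn_loop.simps [simp del]

locale knn_search = compressed_tree R T for R :: "'a::metric_space set" and T +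
  fixes G :: "'a \<Rightarrow> int \<Rightarrow> 'a list" and q :: 'a and k :: nat and \<epsilon> :: real
  assumes groups: "child_groups T G" and k: "1 \<le> k" "k \<le> card R" and \<epsilon>: "0 < \<epsilon>"
begin

text \<open>The conversion by \<open>nat\<close> is faithful, as the logarithm is at least 1 for
  positive \<open>\<epsilon>\<close>.\<close>

definition eps_exp :: nat where
  "eps_exp = nat \<lceil>log 2 (2 + 1 / \<epsilon>)\<rceil>"

lemma eps_exp_ge: "2 + 1 / \<epsilon> \<le> 2 ^ eps_exp"
proof -
  have "0 < 2 + 1 / \<epsilon>" using \<epsilon> by (simp add: add_pos_pos)
  then have "2 + 1 / \<epsilon> = 2 powr (log 2 (2 + 1 / \<epsilon>))" by simp
  also have "\<dots> \<le> 2 powr (real eps_exp)"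
    unfolding eps_exp_def by (intro powr_mono) linarith+
  also have "\<dots> = 2 ^ eps_exp" by (simp add: powr_realpow)
  finally show ?thesis .
qed

lemma R_nonempty: "R \<noteq> {}"
  using root_in by auto

lemma c_m_power_ge_1: "1 \<le> c_m R ^ n"
  using c_m_ge_1[OF fin R_nonempty] by simp

text \<open>In units of \<open>2 powi i\<close>, the radius is the stopping threshold
  \<open>4 / \<epsilon> + 2\<close> plus the pruning slack 4. Packing needs
  \<open>16 / \<epsilon> + 25\<close>, which is at most \<open>16 * (2 + 1 / \<epsilon>)\<close>;
  the 16 is the 4 in the exponent.\<close>

lemma ring_bound:
  assumes "S \<subseteq> cover_set T i" "S \<subseteq> cball q (2 powi i * (4 / \<epsilon> + 6))"
  shows "real (card S) \<le> c_m R ^ (4 + eps_exp)"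
proof (rule card_packing[OF fin R_nonempty _ assms(2)])
  show "S \<subseteq> R" using assms(1) by (auto simp: cover_set_iff)
  show "2 powi i < dist x y" if "x \<in> S" "y \<in> S" "x \<noteq> y" for x y
    using sparse that assms(1) by blast
  have "4 * (2 powi i * (4 / \<epsilon> + 6)) / 2 powi i + 1 = 16 * (1 / \<epsilon>) + 25" by simp
  also have "\<dots> \<le> 16 * 2 ^ eps_exp" using eps_exp_ge by linarith
  finally show "4 * (2 powi i * (4 / \<epsilon> + 6)) / 2 powi i + 1 \<le> 2 ^ (4 + eps_exp)"
    by (simp add: power_add)
qed simp

lemma group_props: "p \<in> R \<Longrightarrow> distinct (G p i) \<and> set (G p i) = {c. is_child T c p \<and> level T c = i}"
  using groups by (auto simp: child_groups_def)

text \<open>The point \<open>p\<close> is counted with its children because both become candidates.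
  All lie within twice the sparsity of \<open>p\<close>, and \<open>4 * 2 + 1\<close> is at most
  \<open>2 ^ 4\<close>.\<close>

lemma group_bound:
  assumes "p \<in> R" "i < level T p"
  shows "real (1 + length (G p i)) \<le> c_m R ^ 4"
proof -
  have "p \<notin> set (G p i)" using group_props[OF assms(1)] is_child_level by auto
  then have "distinct (p # G p i)" using group_props[OF assms(1)] by simp
  from distinct_card[OF this] have "card (insert p (set (G p i))) = 1 + length (G p i)" by simp
  moreover have sub: "insert p (set (G p i)) \<subseteq> cover_set T i"
    using group_props[OF assms(1), of i] assms by (auto simp: cover_set_iff dest: is_child_in)
  have "real (card (insert p (set (G p i)))) \<le> c_m R ^ 4"
  proof (rule card_packing[OF fin R_nonempty, where q = p])
    show "insert p (set (G p i)) \<subseteq> R" using sub by (auto simp: cover_set_iff)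
    show "2 powi i < dist x y" if "x \<in> insert p (set (G p i))" "y \<in> insert p (set (G p i))" "x \<noteq> y" for x y
      using sparse sub that by blast
    show "insert p (set (G p i)) \<subseteq> cball p (2 powi (i + 1))"
      using group_props[OF assms(1), of i] is_child_dist by (auto simp: dist_commute)
    show "4 * 2 powi (i + 1) / 2 powi i + 1 \<le> (2::real) ^ 4" by (simp add: power_int_add)
  qed simp
  ultimately show ?thesis by simp
qed

section \<open>The loop invariant and its preservation\<close>

abbreviation "N \<equiv> NN_upto R q k"

text \<open>Here \<open>i\<close> is the level about to be processed. The sets are taken at
  \<open>i + 1\<close>, however many levels were skipped, so that the next round is always a
  refinement by a single level.\<close>

definition loop_inv :: "'a list \<Rightarrow> int \<Rightarrow> bool" where
  "loop_inv Rs i \<longleftrightarrow> distinct Rs \<and> set Rs \<subseteq> cover_set T (i + 1) \<and>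
     N \<subseteq> (\<Union>p\<in>set Rs. S_set T (i + 1) p) \<and> real (length Rs) \<le> c_m R ^ (4 + eps_exp)"

text \<open>Coverage passes from \<open>i + 1\<close> to \<open>i\<close> by
  \<open>S_set_refine\<close>, whose gap condition is automatic for consecutive levels. Unique
  parents keep the groups disjoint, and their level \<open>i\<close> separates them from
  \<open>Rs\<close>.\<close>

lemma candidates_inv:
  assumes inv: "loop_inv Rs i"
  defines "C \<equiv> result (candidates G i Rs)"
  shows "distinct C" "set C \<subseteq> cover_set T i" "N \<subseteq> (\<Union>p\<in>set C. S_set T i p)"
    "real (length C) \<le> c_m R ^ (8 + eps_exp)"
proof -
  have Rs: "distinct Rs" "set Rs \<subseteq> cover_set T (i + 1)" using inv by (auto simp: loop_inv_def)
  have mC: "mset C = mset (Rs @ concat (map (\<lambda>p. G p i) Rs))"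
    unfolding C_def candidates_props(1) by simp
  have setC: "set C = set Rs \<union> (\<Union>p\<in>set Rs. set (G p i))"
    using mset_eq_setD[OF mC] by simp
  have inR: "p \<in> R" "i < level T p" if "p \<in> set Rs" for p
    using Rs that by (auto simp: cover_set_iff)
  have "distinct (concat (map (\<lambda>p. G p i) ps))" if "distinct ps" "set ps \<subseteq> R" for ps
    using that
  proof (induction ps)
    case (Cons p ps)
    have "set (G p i) \<inter> set (G p' i) = {}" if "p' \<in> set ps" for p'
      using group_props[of p i] group_props[of p' i] Cons.prems that is_child_unique[of _ p p'] by auto
    then show ?case using Cons group_props[of p i] by auto
  qed simp
  then have "distinct (concat (map (\<lambda>p. G p i) Rs))" using Rs inR by blast
  moreover have "set Rs \<inter> (\<Union>p\<in>set Rs. set (G p i)) = {}"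
  proof -
    have "level T c = i" if "c \<in> set (G p i)" "p \<in> set Rs" for c p
      using that group_props[of p i] inR by auto
    then show ?thesis using inR(2) by force
  qed
  ultimately show "distinct C" using mset_eq_imp_distinct_iff[OF mC] Rs by simp
  show "set C \<subseteq> cover_set T i"
    using setC group_props inR by (auto simp: cover_set_iff dest: is_child_in) (simp add: order_less_imp_le)
  have "S_set T (i + 1) p \<subseteq> (\<Union>p\<in>set C. S_set T i p)" if p: "p \<in> set Rs" for p
  proof -
    have "S_set T (i + 1) p = S_set T i p \<union> (\<Union>c\<in>set (G p i). S_set T i c)"
      using S_set_refine[of p "i + 1" i] Rs(2) p group_props[of p i] inR[OF p] by auto
    then show ?thesis using p setC by auto
  qed
  then show "N \<subseteq> (\<Union>p\<in>set C. S_set T i p)" using inv unfolding loop_inv_def by blast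
  have "real (length ps + length (concat (map (\<lambda>p. G p i) ps))) \<le> c_m R ^ 4 * real (length ps)"
    if "set ps \<subseteq> set Rs" for ps
    using that
  proof (induction ps)
    case (Cons p ps)
    then show ?case using group_bound[of p i] inR[of p] by (simp add: algebra_simps)
  qed simp
  from this[of Rs] have "real (length C) \<le> c_m R ^ 4 * real (length Rs)"
    using mset_eq_length[OF mC] by simp
  also have "\<dots> \<le> c_m R ^ 4 * c_m R ^ (4 + eps_exp)"
    using inv c_m_power_ge_1[of 4] by (intro mult_left_mono) (auto simp: loop_inv_def)
  also have "\<dots> = c_m R ^ (8 + eps_exp)" by (simp flip: power_add)
  finally show "real (length C) \<le> c_m R ^ (8 + eps_exp)" .
qed

lemma sum_card_S_set:
  assumes "A \<subseteq> cover_set T i"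
  shows "(\<Sum>p\<in>A. card (S_set T i p)) = card (\<Union>p\<in>A. S_set T i p)"
proof (rule card_UN_disjoint[symmetric])
  show "finite A" by (rule finite_subset[OF _ fin]) (use assms in \<open>auto simp: cover_set_iff\<close>)
  show "\<forall>p\<in>A. \<forall>p'\<in>A. p \<noteq> p' \<longrightarrow> S_set T i p \<inter> S_set T i p' = {}"
    using assms S_set_disjoint by blast
qed (simp add: finite_S_set)

text \<open>The candidates cover \<open>N\<close>, which has at least \<open>k\<close> points, so
  their sizes reach \<open>k\<close> and a \<lambda>-point exists. One half of the slack
  \<open>2 powi (i + 2)\<close> is spent on the points certifying the \<open>k\<close>-th distance,
  the other on the way from a neighbor to the candidate covering it.\<close>

lemma lambda_inv:
  assumes "distinct C" "set C \<subseteq> cover_set T i" "N \<subseteq> (\<Union>p\<in>set C. S_set T i p)"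
  obtains d p where "result (lambda_point T q k i C) = (d, p)"
    "card (\<Union>p\<in>{p\<in>set C. dist q p < d}. S_set T i p) < k"
    "k \<le> card (\<Union>p\<in>{p\<in>set C. dist q p \<le> d}. S_set T i p)"
    "time (lambda_point T q k i C) \<le> length C * (3 * heap_height k + 5) + 3"
    "N \<subseteq> (\<Union>p\<in>{p\<in>set C. dist q p \<le> d + 2 powi (i + 2)}. S_set T i p)"
proof -
  have "1 \<le> card (S_set T i p)" if "p \<in> set C" for p
    using S_set_self[of p i] finite_S_set[of i p] that assms(2)
    by (auto simp: cover_set_iff Suc_le_eq card_gt_0_iff)
  moreover have "k \<le> (\<Sum>p\<in>set C. card (S_set T i p))"
  proof -
    have "k \<le> card N" by (rule card_NN_upto[OF fin k])
    also have "\<dots> \<le> card (\<Union>p\<in>set C. S_set T i p)"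
      by (rule card_mono) (use assms(3) finite_S_set in auto)
    finally show ?thesis using sum_card_S_set[OF assms(2)] by simp
  qed
  ultimately obtain d p where d: "result (lambda_point T q k i C) = (d, p)"
    "(\<Sum>p\<in>{p\<in>set C. dist q p < d}. card (S_set T i p)) < k"
    "k \<le> (\<Sum>p\<in>{p\<in>set C. dist q p \<le> d}. card (S_set T i p))"
    "time (lambda_point T q k i C) \<le> length C * (3 * heap_height k + 5) + 3"
    by (rule lambda_point_props[OF k(1) assms(1)])
  have sub: "{p\<in>set C. Q p} \<subseteq> cover_set T i" for Q using assms(2) by auto
  let ?X = "\<Union>p\<in>{p\<in>set C. dist q p \<le> d}. S_set T i p"
  have kX: "k \<le> card ?X" using d(3) sum_card_S_set[OF sub] by simp
  have "N \<subseteq> (\<Union>p\<in>{p\<in>set C. dist q p \<le> d + 2 powi (i + 2)}. S_set T i p)"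
  proof
    fix u assume u: "u \<in> N"
    then obtain p where p: "p \<in> set C" "u \<in> S_set T i p" using assms(3) by blast
    have "dist q u \<le> d + 2 powi (i + 1)"
    proof (rule NN_upto_dist_le[OF fin k _ kX _ u])
      show "?X \<subseteq> R" using S_set_subset by blast
      fix x assume "x \<in> ?X"
      then obtain p where "dist q p \<le> d" "x \<in> S_set T i p" by blast
      then show "dist q x \<le> d + 2 powi (i + 1)"
        using S_set_dist[of x i p] dist_triangle2[of q x p] by (simp add: dist_commute)
    qed
    then have "dist q p \<le> d + 2 powi (i + 1) + 2 powi (i + 1)"
      using S_set_dist[OF p(2)] dist_triangle[of q p u] by linarith
    also have "\<dots> = d + 2 powi (i + 2)" by (simp add: power_int_add)
    finally show "u \<in> (\<Union>p\<in>{p\<in>set C. dist q p \<le> d + 2 powi (i + 2)}. S_set T i p)"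
      using p by blast
  qed
  then show thesis using that d sum_card_S_set[OF sub] by simp
qed

text \<open>The bound on \<open>d\<close> comes from the failed stopping test and puts the retained
  points into a ball comparable to \<open>2 powi i\<close>. Their number is thus bounded afresh,
  independently of the previous round.\<close>

lemma descend_inv:
  assumes C: "distinct C" "set C \<subseteq> cover_set T i"
    and N: "N \<subseteq> (\<Union>p\<in>{p\<in>set C. dist q p \<le> d + 2 powi (i + 2)}. S_set T i p)"
    and d: "d < 2 powi (i + 2) / \<epsilon> + 2 powi (i + 1)"
    and j: "j < i" "\<And>p. p \<in> set C \<Longrightarrow> dist q p \<le> d + 2 powi (i + 2) \<Longrightarrow> Next T p i \<le> j"
  shows "loop_inv (filter (\<lambda>p. dist q p \<le> d + 2 powi (i + 2)) C) j"
proof -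
  let ?Rs = "filter (\<lambda>p. dist q p \<le> d + 2 powi (i + 2)) C"
  have sub: "set ?Rs \<subseteq> cover_set T i" using C by auto
  have "S_set T i p \<subseteq> S_set T (j + 1) p" if p: "p \<in> set ?Rs" for p
  proof (cases "j + 1 = i")
    case False
    have gap: "level T c \<le> j" if "is_child T c p" "level T c < i" for c
      using child_le_Next[OF that] j(2)[of p] p by auto
    \<comment> \<open>Levels strictly between \<open>j\<close> and \<open>i\<close> hold no children
      of \<open>p\<close>, so refining down to \<open>j + 1\<close> adds no group.\<close>
    then have "{c. is_child T c p \<and> level T c = j + 1} = {}" using False j(1) by force
    then show ?thesis
      using S_set_refine[of p i "j + 1"] gap p sub False j(1) by fastforce
  qed simp
  moreover have "set ?Rs \<subseteq> cover_set T (j + 1)" using sub j(1) by (auto simp: cover_set_iff)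
  moreover have "set ?Rs \<subseteq> cball q (2 powi i * (4 / \<epsilon> + 6))"
  proof
    fix p assume "p \<in> set ?Rs"
    then have "dist q p \<le> 2 powi (i + 2) / \<epsilon> + 2 powi (i + 1) + 2 powi (i + 2)"
      using d by simp
    also have "\<dots> = 2 powi i * (4 / \<epsilon> + 6)" by (simp add: power_int_add algebra_simps)
    finally show "p \<in> cball q (2 powi i * (4 / \<epsilon> + 6))" by simp
  qed
  then have "real (card (set ?Rs)) \<le> c_m R ^ (4 + eps_exp)" using ring_bound sub by blast
  moreover have "card (set ?Rs) = length ?Rs" by (rule distinct_card) (use C(1) in simp)
  ultimately show ?thesis using C(1) N unfolding loop_inv_def by fastforce
qed

lemma stop_result:
  assumes C: "distinct C" "set C \<subseteq> cover_set T i" "N \<subseteq> (\<Union>p\<in>set C. S_set T i p)"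
    and less: "card (\<Union>p\<in>{p\<in>set C. dist q p < d}. S_set T i p) < k"
    and ge: "k \<le> card (\<Union>p\<in>{p\<in>set C. dist q p \<le> d}. S_set T i p)"
    and stop: "2 powi (i + 2) / \<epsilon> + 2 powi (i + 1) \<le> d"
  shows "approx_knn_set R q k \<epsilon> (set (result (list_descendants T G k
    [Siblings (filter (\<lambda>p. dist q p < d) C) i, Siblings (filter (\<lambda>p. dist q p = d) C) i])))"
    (is "approx_knn_set R q k \<epsilon> (set (result (list_descendants T G k ?ts)))")
proof -
  have "compressed_tree R T" by unfold_locales
  then obtain Ls where Ls: "list_all2 (\<lambda>t L. distinct L \<and> set L = task_points T t) ?ts Ls"
    "result (list_descendants T G k ?ts) = take k (concat Ls)"
    using list_descendants_result[of R T G ?ts k] groups C by auto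
  then obtain L1 L2 where L: "Ls = [L1, L2]" "distinct L1" "distinct L2"
    "set L1 = (\<Union>p\<in>{p\<in>set C. dist q p < d}. S_set T i p)"
    "set L2 = (\<Union>p\<in>{p\<in>set C. dist q p = d}. S_set T i p)"
    by (auto simp: list_all2_Cons1)
  have "S_set T i p \<inter> S_set T i p' = {}" if "p \<in> set C" "p' \<in> set C" "p \<noteq> p'" for p p'
    using S_set_disjoint[of p i p'] C(2) that by auto
  then have "set L1 \<inter> set L2 = {}" unfolding L(4,5) by fastforce
  then have dist12: "distinct (L1 @ L2)" using L by simp
  have un: "set (L1 @ L2) = (\<Union>p\<in>{p\<in>set C. dist q p \<le> d}. S_set T i p)"
    using L(4,5) by (auto simp: order_le_less)
  have len: "k \<le> length (L1 @ L2)"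
    using ge distinct_card[OF dist12] unfolding un by simp
  \<comment> \<open>The sets of the strictly nearer candidates have fewer than \<open>k\<close>
    points in total, so the cut leaves them whole.\<close>
  have len1: "length L1 < k" using less distinct_card[OF L(2)] L(4) by simp
  let ?P = "set (take k (L1 @ L2))"
  have PU: "?P \<subseteq> (\<Union>p\<in>{p\<in>set C. dist q p \<le> d}. S_set T i p)"
    using set_take_subset[of k "L1 @ L2"] un by simp
  have P1: "set L1 \<subseteq> ?P" using len1 by simp
  have "approx_knn_set R q k \<epsilon> ?P"
  proof (rule approx_knn_setI[OF fin k _ _ \<epsilon>])
    show "?P \<subseteq> R" using PU S_set_subset by blast
    show "card ?P = k" using dist12 len distinct_card[OF distinct_take[OF dist12, of k]] by simp
    fix p u assume p: "p \<in> ?P - N" and u: "u \<in> N - ?P"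
    obtain p' where p': "dist q p' \<le> d" "p \<in> S_set T i p'" using p PU by blast
    obtain u' where u': "u' \<in> set C" "u \<in> S_set T i u'" using u C(3) by blast
    \<comment> \<open>A missed neighbor cannot be covered by a strictly nearer candidate, since
      those sets are output completely.\<close>
    have "d \<le> dist q u'" using u u' P1 L(4) by force
    then have dle: "d \<le> dist q u + 2 powi (i + 1)"
      using S_set_dist[OF u'(2)] dist_triangle[of q u' u] by linarith
    have "dist q p \<le> d + 2 powi (i + 1)"
      using p' S_set_dist[OF p'(2)] dist_triangle2[of q p p'] by (simp add: dist_commute)
    \<comment> \<open>Solved for \<open>d\<close>, this inequality is exactly the stopping
      test.\<close>
    also have "\<dots> \<le> (1 + \<epsilon>) * (d - 2 powi (i + 1))"
      using stop \<epsilon> by (simp add: field_simps power_int_add)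
    also have "\<dots> \<le> (1 + \<epsilon>) * dist q u" using dle \<epsilon> by (intro mult_left_mono) auto
    finally show "dist q p \<le> (1 + \<epsilon>) * dist q u" .
  qed
  then show ?thesis using Ls(2) L(1) by simp
qed

text \<open>At \<open>i + 1 \<le> l_min T\<close> the covering sets are singletons, so
  \<open>Rs\<close> itself contains \<open>N\<close> and the selection is exact.\<close>

lemma final_result:
  assumes inv: "loop_inv Rs i" and i: "i < l_min T"
  shows "approx_knn_set R q k \<epsilon> (snd ` set (result (k_nearest q k Rs)))"
proof -
  have Rs: "distinct Rs" "set Rs \<subseteq> R" using inv by (auto simp: loop_inv_def cover_set_iff)
  have "S_set T (i + 1) p = {p}" if "p \<in> set Rs" for p
    using S_set_bottom that Rs i by auto
  then have NRs: "N \<subseteq> set Rs" using inv by (auto simp: loop_inv_def)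
  let ?xs = "result (k_nearest q k Rs)"
  let ?f = "\<lambda>p. (dist q p, p)"
  obtain D where D: "mset ?xs + D = image_mset ?f (mset Rs)" "length ?xs = min k (length Rs)"
    "\<forall>x\<in>set ?xs. \<forall>y\<in>#D. fst x \<le> fst y"
    by (rule k_nearest_props[OF k(1), of q Rs])
  have "k \<le> length Rs"
    using card_NN_upto[OF fin k, of q] card_mono[OF _ NRs] distinct_card[OF Rs(1)] by simp
  have "mset (map snd ?xs) + image_mset snd D = image_mset snd (mset ?xs + D)" by simp
  also have "\<dots> = mset Rs" unfolding D(1) by (simp add: multiset.map_comp comp_def)
  finally have m: "mset (map snd ?xs) + image_mset snd D = mset Rs" .
  obtain ys where ys: "mset ys = image_mset snd D" using ex_mset by blast
  have eq: "mset (map snd ?xs @ ys) = mset Rs" using m ys by simp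
  then have dys: "distinct (map snd ?xs @ ys)" using mset_eq_imp_distinct_iff Rs(1) by blast
  have setRs: "set (map snd ?xs @ ys) = set Rs" using mset_eq_setD[OF eq] .
  have inRs: "fst x = dist q (snd x)" if "x \<in># mset ?xs + D" for x
    using that unfolding D(1) by auto
  show ?thesis
  proof (rule approx_knn_setI[OF fin k _ _ \<epsilon>])
    show "snd ` set ?xs \<subseteq> R" using setRs Rs(2) by auto
    have "card (set (map snd ?xs)) = length ?xs" using dys by (simp add: distinct_card del: set_map)
    then show "card (snd ` set ?xs) = k" using D(2) \<open>k \<le> length Rs\<close> by simp
    fix p u assume p: "p \<in> snd ` set ?xs - N" and u: "u \<in> N - snd ` set ?xs"
    obtain x where x: "x \<in> set ?xs" "p = snd x" using p by blast
    have "u \<in> set ys" using u NRs setRs by auto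
    then have "u \<in># image_mset snd D" using ys by (metis set_mset_mset)
    then obtain y where y: "y \<in># D" "u = snd y" by auto
    have "dist q p \<le> dist q u" using D(3) x y inRs[of x] inRs[of y] by fastforce
    also have "\<dots> \<le> (1 + \<epsilon>) * dist q u" using \<epsilon> by (simp add: mult_le_cancel_right1)
    finally show "dist q p \<le> (1 + \<epsilon>) * dist q u" .
  qed
qed

text \<open>Per candidate: 2 steps for collecting it, \<open>3 * heap_height k + 5\<close> for the
  \<lambda>-point and at most 3 for the remaining passes. The other 8 of the 18 absorb the constant
  overhead, as the power of \<open>c_m R\<close> is at least 1.\<close>

definition round_cost :: real where
  "round_cost = c_m R ^ (8 + eps_exp) * (3 * real (heap_height k) + 18)"

lemma round_costI:
  assumes "real n \<le> c_m R ^ (8 + eps_exp)" "b \<le> 8"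
  shows "real n * (3 * real (heap_height k) + 10) + b \<le> round_cost"
proof -
  have "real n * (3 * real (heap_height k) + 10) \<le> c_m R ^ (8 + eps_exp) * (3 * real (heap_height k) + 10)"
    using assms by (intro mult_right_mono) auto
  moreover have "b \<le> c_m R ^ (8 + eps_exp) * 8" using assms(2) c_m_power_ge_1[of "8 + eps_exp"] by simp
  ultimately show ?thesis unfolding round_cost_def by (simp add: algebra_simps)
qed

lemma round_cost_nonneg: "0 \<le> round_cost"
  unfolding round_cost_def using c_m_power_ge_1[of "8 + eps_exp"] by simp

text \<open>The level drops by at least one per round; the extra round pays for the final selection.
  The part \<open>5 * real k + 3\<close> does not accumulate, since only an early stop lists
  descendants.\<close>

lemma knn_loop_correct:
  assumes "loop_inv Rs i"
  shows "approx_knn_set R q k \<epsilon> (set (result (knn_loop T G q k \<epsilon> Rs i))) \<and>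
    real (time (knn_loop T G q k \<epsilon> Rs i)) \<le> round_cost * (real (nat (i - l_min T + 1)) + 1) + 5 * real k + 3"
  using assms
proof (induction "nat (i - l_min T + 1)" arbitrary: Rs i rule: less_induct)
  case less
  show ?case
  proof (cases "i < l_min T")
    case True
    have e: "knn_loop T G q k \<epsilon> Rs i =
        bind_timed (step (l_min T)) (\<lambda>_. bind_timed (k_nearest q k Rs) points_of)"
      using True by (subst knn_loop.simps) (simp add: bind_timed_def)
    obtain D where D: "length (result (k_nearest q k Rs)) = min k (length Rs)"
      "time (k_nearest q k Rs) \<le> length Rs * (3 * heap_height k + 4) + 2"
      by (rule k_nearest_props[OF k(1), of q Rs])
    have "time (knn_loop T G q k \<epsilon> Rs i) \<le> length Rs * (3 * heap_height k + 10) + 4"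
      unfolding e using D by (simp add: points_of_props algebra_simps)
    then have "real (time (knn_loop T G q k \<epsilon> Rs i)) \<le> real (length Rs * (3 * heap_height k + 10) + 4)"
      by (simp only: of_nat_le_iff)
    also have "\<dots> = real (length Rs) * (3 * real (heap_height k) + 10) + 4" by simp
    also have "real (length Rs) \<le> c_m R ^ (8 + eps_exp)"
    proof -
      have "real (length Rs) \<le> c_m R ^ (4 + eps_exp)" using less.prems by (simp add: loop_inv_def)
      also have "\<dots> \<le> c_m R ^ (8 + eps_exp)"
        using c_m_ge_1[OF fin R_nonempty] by (intro power_increasing) auto
      finally show ?thesis .
    qed
    note round_costI[OF this, of 4]
    finally show ?thesis
      using final_result[OF less.prems True] True unfolding e by (simp add: points_of_props)
  next
    case False
    let ?C = "result (candidates G i Rs)"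
    note C = candidates_inv[OF less.prems]
    obtain d p where d: "result (lambda_point T q k i ?C) = (d, p)"
      "card (\<Union>p\<in>{p\<in>set ?C. dist q p < d}. S_set T i p) < k"
      "k \<le> card (\<Union>p\<in>{p\<in>set ?C. dist q p \<le> d}. S_set T i p)"
      "time (lambda_point T q k i ?C) \<le> length ?C * (3 * heap_height k + 5) + 3"
      "N \<subseteq> (\<Union>p\<in>{p\<in>set ?C. dist q p \<le> d + 2 powi (i + 2)}. S_set T i p)"
      by (rule lambda_inv[OF C(1-3)])
    have tc: "time (candidates G i Rs) \<le> 2 * length ?C + 1" by (rule candidates_props(2))
    let ?Rs = "filter (\<lambda>p. dist q p \<le> d + 2 powi (i + 2)) ?C"
    let ?M = "max_Next T i ?Rs (l_min T - 1)"
    let ?ts = "[Siblings (filter (\<lambda>p. dist q p < d) ?C) i, Siblings (filter (\<lambda>p. dist q p = d) ?C) i]"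
    show ?thesis
    proof (cases "2 powi (i + 2) / \<epsilon> + 2 powi (i + 1) \<le> d")
      case True
      have r: "result (knn_loop T G q k \<epsilon> Rs i) = result (list_descendants T G k ?ts)"
        using True False d(1) by (subst knn_loop.simps) (simp add: filter_dist_props)
      have t: "time (knn_loop T G q k \<epsilon> Rs i) = 1 + time (candidates G i Rs) +
          time (lambda_point T q k i ?C) + 3 * (length ?C + 1) + time (list_descendants T G k ?ts)"
        using True False d(1) by (subst knn_loop.simps) (simp add: filter_dist_props)
      have "compressed_tree R T" by unfold_locales
      from list_descendants_time[OF this groups, of k ?ts]
      have "time (list_descendants T G k ?ts) \<le> 5 * k + 3" by simp
      then have "time (knn_loop T G q k \<epsilon> Rs i) \<le> length ?C * (3 * heap_height k + 10) + 8 + (5 * k + 3)"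
        unfolding t using tc d(4) by (simp add: algebra_simps)
      then have "real (time (knn_loop T G q k \<epsilon> Rs i)) \<le>
          real (length ?C * (3 * heap_height k + 10) + 8 + (5 * k + 3))"
        by (simp only: of_nat_le_iff)
      also have "\<dots> = (real (length ?C) * (3 * real (heap_height k) + 10) + 8) + (5 * real k + 3)" by simp
      also have "\<dots> \<le> round_cost * 1 + (5 * real k + 3)" using round_costI[OF C(4), of 8] by simp
      also have "\<dots> \<le> round_cost * (real (nat (i - l_min T + 1)) + 1) + (5 * real k + 3)"
        using round_cost_nonneg by (intro add_right_mono mult_left_mono) auto
      finally show ?thesis using stop_result[OF C(1-3) d(2,3) True] r by simp
    next
      case go: False
      let ?j = "result ?M"
      have r: "result (knn_loop T G q k \<epsilon> Rs i) = result (knn_loop T G q k \<epsilon> ?Rs ?j)"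
        using go False d(1) by (subst knn_loop.simps) (simp add: filter_dist_props)
      have t: "time (knn_loop T G q k \<epsilon> Rs i) = 1 + time (candidates G i Rs) +
          time (lambda_point T q k i ?C) + (length ?C + 1) + (length ?Rs + 1) +
          time (knn_loop T G q k \<epsilon> ?Rs ?j)"
        using go False d(1) by (subst knn_loop.simps) (simp add: filter_dist_props max_Next_time)
      have j: "?j < i" using False by (intro max_Next_less) auto
      have j': "l_min T - 1 \<le> ?j" "\<forall>a\<in>set ?Rs. Next T a i \<le> ?j"
        using max_Next_ge[of "l_min T - 1" T i ?Rs] by auto
      have "loop_inv ?Rs ?j"
        by (rule descend_inv[OF C(1,2) d(5)]) (use go j j' in auto)
      then have IH: "approx_knn_set R q k \<epsilon> (set (result (knn_loop T G q k \<epsilon> ?Rs ?j)))"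
        "real (time (knn_loop T G q k \<epsilon> ?Rs ?j)) \<le>
           round_cost * (real (nat (?j - l_min T + 1)) + 1) + 5 * real k + 3"
        using less.hyps[of ?j ?Rs] j False by auto
      obtain n where n: "length ?Rs = n" "n \<le> length ?C" using length_filter_le by blast
      have "time (knn_loop T G q k \<epsilon> Rs i) \<le>
          (length ?C * (3 * heap_height k + 10) + 7) + time (knn_loop T G q k \<epsilon> ?Rs ?j)"
        unfolding t n(1) using tc d(4) n(2) by (simp add: algebra_simps)
      then have "real (time (knn_loop T G q k \<epsilon> Rs i)) \<le>
          real ((length ?C * (3 * heap_height k + 10) + 7) + time (knn_loop T G q k \<epsilon> ?Rs ?j))"
        by (simp only: of_nat_le_iff)
      also have "\<dots> = (real (length ?C) * (3 * real (heap_height k) + 10) + 7) +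
          real (time (knn_loop T G q k \<epsilon> ?Rs ?j))" by simp
      also have "\<dots> \<le> round_cost + (round_cost * (real (nat (?j - l_min T + 1)) + 1) + 5 * real k + 3)"
        using round_costI[OF C(4), of 7] IH(2) by linarith
      also have "\<dots> = round_cost * (real (nat (?j - l_min T + 1)) + 2) + 5 * real k + 3"
        by (simp add: algebra_simps)
      also have "\<dots> \<le> round_cost * (real (nat (i - l_min T + 1)) + 1) + 5 * real k + 3"
        using round_cost_nonneg j False by (intro add_right_mono mult_left_mono) auto
      finally show ?thesis using IH(1) r by simp
    qed
  qed
qed

section \<open>Initialization and the number of rounds\<close>

lemma level_lt_l_max:
  assumes "p \<in> R" "p \<noteq> root T"
  shows "level T p < l_max T"
proof -
  have "level T p \<le> Max (level T ` (R - {root T}))" using assms by (intro Max_ge) auto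
  moreover have "R \<noteq> {root T}" using assms by auto
  ultimately show ?thesis by (simp add: l_max_def)
qed

lemma l_max_le_root: "l_max T \<le> level T (root T)"
proof (cases "R = {root T}")
  case False
  then have "R - {root T} \<noteq> {}" using root_in by auto
  then have "Max (level T ` (R - {root T})) \<in> level T ` (R - {root T})" by (intro Max_in) auto
  then show ?thesis using False level_root by (auto simp: l_max_def)
qed (simp add: l_max_def)

lemma initial_inv: "loop_inv [root T] (l_max T - 1)"
proof -
  have "S_set T (l_max T) (root T) = R" by (rule S_set_root) (rule level_lt_l_max)
  moreover have "N \<subseteq> R" by (auto simp: NN_upto_def NN_def)
  ultimately show ?thesis
    using l_max_le_root root_in c_m_power_ge_1[of "4 + eps_exp"] by (simp add: loop_inv_def cover_set_iff)
qed

text \<open>A point of level \<open>l_max T - 1\<close> and the root are both in that cover set, so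
  the diameter exceeds \<open>2 powi (l_max T - 1)\<close>. A point of level \<open>l_min T\<close>
  is within \<open>2 powi (l_min T + 1)\<close> of its parent, which bounds \<open>d_min R\<close>.
  The quotient leaves the 2.\<close>

lemma l_max_l_min: "real_of_int (l_max T - l_min T) \<le> 2 + max 1 (log 2 (aspect_ratio R))"
proof (cases "R = {root T}")
  case True
  then show ?thesis by (simp add: l_max_def l_min_def)
next
  case False
  then have ne: "R - {root T} \<noteq> {}" using root_in by auto
  then have "Max (level T ` (R - {root T})) \<in> level T ` (R - {root T})" by (intro Max_in) auto
  then obtain p where p: "p \<in> R" "p \<noteq> root T" "l_max T = 1 + level T p"
    using False by (auto simp: l_max_def)
  have "l_min T \<in> level T ` R" unfolding l_min_def using R_nonempty by (simp add: Min_in)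
  then obtain p0 where p0: "p0 \<in> R" "l_min T = level T p0" by auto
  have "p0 \<noteq> root T" using l_min_le[OF p(1)] level_root[OF p(1,2)] p0 by auto
  then have ch: "is_child T p0 (parent T p0)" using p0 by (simp add: is_child_iff)
  let ?D = "{dist x y | x y. x \<in> R \<and> y \<in> R \<and> x \<noteq> y}"
  have "?D \<subseteq> (\<lambda>(x, y). dist x y) ` (R \<times> R)" by auto
  then have finD: "finite ?D" using finite_subset by fastforce
  have inD: "dist p0 (parent T p0) \<in> ?D"
    using is_child_in[OF ch] is_child_level[OF ch]
    by (intro CollectI exI[of _ p0] exI[of _ "parent T p0"]) auto
  have "d_min R \<in> ?D" unfolding d_min_def using finD inD by (intro Min_in) auto
  then have dpos: "0 < d_min R" by auto
  have "d_min R \<le> dist p0 (parent T p0)" unfolding d_min_def using finD inD by (rule Min_le)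
  also have "\<dots> \<le> 2 powi (l_min T + 1)" using is_child_dist[OF ch] p0 by simp
  finally have dle: "d_min R \<le> 2 powi (l_min T + 1)" .
  have "2 powi (l_max T - 1) < dist p (root T)"
    using sparse[of p "level T p" "root T"] p root_in level_root[OF p(1,2)] by (simp add: cover_set_iff)
  also have "\<dots> \<le> diameter R"
    using p root_in fin by (intro diameter_bounded_bound) (auto intro: finite_imp_bounded)
  finally have diam: "2 powi (l_max T - 1) < diameter R" .
  have "2 powr real_of_int (l_max T - l_min T - 2) = (2::real) powi (l_max T - l_min T - 2)"
    by (rule powr_real_of_int') simp_all
  also have "\<dots> = 2 powi ((l_max T - 1) - (l_min T + 1))" by (simp add: algebra_simps)
  also have "\<dots> = 2 powi (l_max T - 1) / 2 powi (l_min T + 1)" by (rule power_int_diff) simp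
  also have "\<dots> \<le> 2 powi (l_max T - 1) / d_min R"
    using dle dpos by (intro divide_left_mono) auto
  also have "\<dots> \<le> aspect_ratio R"
    unfolding aspect_ratio_def using diam dpos by (intro divide_right_mono) auto
  finally have le: "2 powr real_of_int (l_max T - l_min T - 2) \<le> aspect_ratio R" .
  then have "0 < aspect_ratio R" by (rule less_le_trans[rotated]) simp
  then have "real_of_int (l_max T - l_min T - 2) \<le> log 2 (aspect_ratio R)"
    using le by (simp add: le_log_iff)
  then show ?thesis by simp
qed

lemma heap_height_le: "real (heap_height k) \<le> 2 * max 1 (log 2 (real k))"
proof -
  have "real (nat \<lfloor>log 2 (real k)\<rfloor>) \<le> log 2 (real k)" using k by simp
  then show ?thesis unfolding heap_height_def by simp
qed

lemma ApproxkNN_correct: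
  "approx_knn_set R q k \<epsilon> (set (result (ApproxkNN T G q k \<epsilon>))) \<and>
    real (time (ApproxkNN T G q k \<epsilon>)) \<le>
      bigO_const *
        (c_m R powi (8 + \<lceil>log 2 (2 + 1 / \<epsilon>)\<rceil>) *
           max 1 (log 2 (real k)) * max 1 (log 2 (aspect_ratio R)) + real k)"
proof -
  let ?L = "max 1 (log 2 (real k))" and ?D = "max 1 (log 2 (aspect_ratio R))"
  let ?M = "c_m R ^ (8 + eps_exp)"
  note loop = knn_loop_correct[OF initial_inv]
  have M: "1 \<le> ?M" by (rule c_m_power_ge_1)
  have "1 \<le> log 2 (2 + 1 / \<epsilon>)" using \<epsilon> by (simp add: le_log_iff add_pos_pos)
  then have "8 + \<lceil>log 2 (2 + 1 / \<epsilon>)\<rceil> = int (8 + eps_exp)" unfolding eps_exp_def by linarith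
  then have pow: "c_m R powi (8 + \<lceil>log 2 (2 + 1 / \<epsilon>)\<rceil>) = ?M" by (simp only: power_int_of_nat)
  \<comment> \<open>The difference of levels is at most \<open>2 + ?D\<close>; one more is at most
    \<open>4 * ?D\<close> because \<open>?D\<close> is at least 1.\<close>
  have rounds: "real (nat (l_max T - 1 - l_min T + 1)) + 1 \<le> 4 * ?D"
    using l_max_l_min by linarith
  \<comment> \<open>The heap height is at most \<open>2 * ?L\<close>, and \<open>6 * ?L + 18\<close>
    is at most \<open>24 * ?L\<close>.\<close>
  have cost: "round_cost \<le> ?M * (24 * ?L)"
    unfolding round_cost_def using heap_height_le M by (intro mult_left_mono) auto
  have "real (time (ApproxkNN T G q k \<epsilon>)) \<le>
      1 + (round_cost * (real (nat (l_max T - 1 - l_min T + 1)) + 1) + 5 * real k + 3)"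
    using loop by (simp add: ApproxkNN_def)
  also have "\<dots> \<le> 1 + (?M * (24 * ?L) * (4 * ?D) + 5 * real k + 3)"
    using rounds cost round_cost_nonneg M
    by (intro add_left_mono add_right_mono mult_mono) auto
  also have "\<dots> = 96 * (?M * ?L * ?D) + 5 * real k + 4" by simp
  also have "\<dots> \<le> bigO_const * (?M * ?L * ?D + real k)"
  proof -
    have "0 \<le> ?M * ?L * ?D" using M by simp
    moreover have "1 \<le> real k" using k by simp
    ultimately show ?thesis unfolding bigO_const_def by (simp add: algebra_simps)
  qed
  finally have "real (time (ApproxkNN T G q k \<epsilon>)) \<le> bigO_const * (?M * ?L * ?D + real k)" .
  moreover have "result (ApproxkNN T G q k \<epsilon>) = result (knn_loop T G q k \<epsilon> [root T] (l_max T - 1))"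
    by (simp add: ApproxkNN_def)
  ultimately show ?thesis using loop unfolding pow by (simp only: simp_thms)
qed

end

theorem theoremG6:
  fixes R :: "'a::metric_space set" and T :: "'a cover_tree" and G :: "'a \<Rightarrow> int \<Rightarrow> 'a list"
    and q :: 'a and k :: nat and \<epsilon> :: real
  assumes "finite R"
    and "compressed_cover_tree R T"
    and "child_groups T G"
    and "1 \<le> k" and "k \<le> card R"
    and "0 < \<epsilon>"
  shows "approx_knn_set R q k \<epsilon> (set (result (ApproxkNN T G q k \<epsilon>))) \<and>
    real (time (ApproxkNN T G q k \<epsilon>)) \<le>
      bigO_const *
        (c_m R powi (8 + \<lceil>log 2 (2 + 1 / \<epsilon>)\<rceil>) *
           max 1 (log 2 (real k)) * max 1 (log 2 (aspect_ratio R)) + real k)"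
proof -
  interpret knn_search R T G q k \<epsilon>
    by unfold_locales (use assms in auto)
  show ?thesis by (rule ApproxkNN_correct)
qed

end
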